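(* Let $p_o>0$ and let $(\Delta_\delta)_{0<\delta\le p_o}$ be a family of functions each satisfying conditions (i)–(v) of the context. Then for every $y_o\in\mathbb R$, \[ \bar N[f^o_{p_o,y_o}]:=\lim_{\delta\to0^+}\bar N[f^\delta_{p_o,y_o}]=\frac12\,\frac{1}{e^{2\pi p_o}-1},\] and consequently \[ \lim_{y_o\to\pm\infty}\ \lim_{\delta\to0^+}\Big(\bar N[f^\delta_{p_o,y_o}]-\tfrac12\bar N^{Th}_{2\pi}[f^\delta_{p_o,y_o}]\Big)=0.\]
   Context: Fourier transforms: $\tilde g(p)=(2\pi)^{-1/2}\int g(y)e^{-ipy}dy$; $\theta$ is the Heaviside step function. Wave packet: for $p_o\ge\delta>0$, let $\Delta_\delta:\mathbb R\to\mathbb R$ and define $f^\delta_{p_o}$ by $\tilde f^\delta_{p_o}(p)=\theta(p)\sqrt{2|p|}\,\Delta_\delta(p-p_o)$, with: (i) $\int|\Delta_\delta|^2=1$; (ii) support of $\Delta_\delta$ in $(-\delta,\delta)$; (iii) $\tilde f^\delta_{p_o}\in C^r(\mathbb R)$ for some $r\ge0$, its derivatives of order $0,\dots,r$ vanish at the origin and at infinity, the $(r+1)$-th derivative exists a.e. and is bounded, the $(r+2)$-th exists a.e. and is integrable; (iv) $\Delta_\delta$ real and nonnegative; (v) $f^\delta_{p_o}$ and its derivative integrable. Set $f^\delta_{p_o,y_o}(y)=f^\delta_{p_o}(y-y_o)$. The generalised function $f^o_{p_o,y_o}$ is the limit $\delta\to0^+$ of $f^\delta_{p_o,y_o}$ (a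 state with momentum exactly $p_o$). With $x(y)=-\log(1+e^{-y})$: $\widetilde{\check f}(-k)=(2\pi)^{-1/2}\int f(y)e^{ikx(y)}dy$, $\bar N[f]=\int_0^\infty\frac{dk}{2k}|\widetilde{\check f}(-k)|^2$, $\bar N^{Th}_{2\pi}[f]=\int_0^\infty\frac{dp}{2p}\frac{|\tilde f(p)|^2}{e^{2\pi p}-1}$. *)

theory Defs
  imports "HOL-Analysis.Analysis"
begin

definition FT :: "(real \<Rightarrow> complex) \<Rightarrow> real \<Rightarrow> complex" where
  "FT g p = complex_of_real (1 / sqrt (2 * pi)) * (LINT y|lborel. g y * cis (- (p * y)))"

definition invFT :: "(real \<Rightarrow> complex) \<Rightarrow> real \<Rightarrow> complex" where
  "invFT h y = complex_of_real (1 / sqrt (2 * pi)) * (LINT p|lborel. h p * cis (p * y))"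

definition wave_ft :: "real \<Rightarrow> (real \<Rightarrow> real) \<Rightarrow> real \<Rightarrow> real" where
  "wave_ft po D p = (if p > 0 then sqrt (2 * \<bar>p\<bar>) * D (p - po) else 0)"

definition wave :: "real \<Rightarrow> (real \<Rightarrow> real) \<Rightarrow> real \<Rightarrow> complex" where
  "wave po D = invFT (\<lambda>p. complex_of_real (wave_ft po D p))"

definition shift :: "real \<Rightarrow> (real \<Rightarrow> complex) \<Rightarrow> real \<Rightarrow> complex" where
  "shift y0 g y = g (y - y0)"

definition xmap :: "real \<Rightarrow> real" where
  "xmap y = - ln (1 + exp (- y))"

text \<open>checkft f k stands for the transform tilde(check f)(-k).\<close>
definition checkft :: "(real \<Rightarrow> complex) \<Rightarrow> real \<Rightarrow> complex" where
  "checkft f k = complex_of_real (1 / sqrt (2 * pi)) * (LINT y|lborel. f y * cis (k * xmap y))"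

definition Nbar :: "(real \<Rightarrow> complex) \<Rightarrow> ennreal" where
  "Nbar f = (\<integral>\<^sup>+ k. ennreal ((cmod (checkft f k))\<^sup>2 / (2 * k)) * indicator {0<..} k \<partial>lborel)"

definition NTh :: "(real \<Rightarrow> complex) \<Rightarrow> ennreal" where
  "NTh f = (\<integral>\<^sup>+ p. ennreal ((cmod (FT f p))\<^sup>2 / (2 * p) / (exp (2 * pi * p) - 1))
              * indicator {0<..} p \<partial>lborel)"

definition regularity_cond :: "nat \<Rightarrow> (real \<Rightarrow> real) \<Rightarrow> bool" where
  "regularity_cond r g \<longleftrightarrow> (\<exists>D :: nat \<Rightarrow> real \<Rightarrow> real.
     D 0 = g \<and>
     (\<forall>k<r. \<forall>x. (D k has_real_derivative D (Suc k) x) (at x)) \<and>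
     continuous_on UNIV (D r) \<and>
     (\<forall>k\<le>r. D k 0 = 0 \<and> (D k \<longlongrightarrow> 0) at_infinity) \<and>
     (AE x in lborel. (D r has_real_derivative D (Suc r) x) (at x)) \<and>
     (\<exists>B. AE x in lborel. \<bar>D (Suc r) x\<bar> \<le> B) \<and>
     (AE x in lborel. (D (Suc r) has_real_derivative D (Suc (Suc r)) x) (at x)) \<and>
     integrable lborel (D (Suc (Suc r))))"

definition packet_conds :: "real \<Rightarrow> real \<Rightarrow> (real \<Rightarrow> real) \<Rightarrow> bool" where
  "packet_conds po \<delta> D \<longleftrightarrow>
     D \<in> borel_measurable borel \<and>
     \<comment> \<open>(i)\<close> (\<integral>\<^sup>+ p. ennreal ((D p)\<^sup>2) \<partial>lborel) = 1 \<and>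
     \<comment> \<open>(ii)\<close> closure {p. D p \<noteq> 0} \<subseteq> {-\<delta><..<\<delta>} \<and>
     \<comment> \<open>(iii)\<close> (\<exists>r. regularity_cond r (wave_ft po D)) \<and>
     \<comment> \<open>(iv)\<close> (\<forall>p. 0 \<le> D p) \<and>
     \<comment> \<open>(v)\<close> integrable lborel (wave po D) \<and>
       (\<exists>f'. (\<forall>y. (wave po D has_vector_derivative f' y) (at y)) \<and> integrable lborel f')"

end

theory Submission
  imports Defs "HOL-Probability.Characteristic_Functions"
begin

text \<open>Writing \<open>g = wave_ft po D\<close>, the substitution \<open>u = e\<^sup>x = 1 / (1 + e\<^sup>-\<^sup>y)\<close> turns \<open>checkft f k\<close> into the
  integral of \<open>g(p) e\<^sup>-\<^sup>i\<^sup>p\<^sup>y\<^sup>0\<close> against the Beta function \<open>B(i(p + k), -ip)\<close>. Put \<open>k = e\<^sup>s\<close>. For \<open>s \<le> 0\<close> this kernel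
  is \<open>O(e\<^sup>s)\<close>, and for \<open>s \<ge> 0\<close> it equals \<open>A(p) e\<^sup>i\<^sup>p\<^sup>s + O(e\<^sup>-\<^sup>s)\<close> with
  \<open>\<bar>A(p)\<bar>\<^sup>2 = 2\<pi> / (p (e\<^sup>2\<^sup>\<pi>\<^sup>p - 1))\<close>. The \<open>L\<^sup>1\<close> norm of \<open>D\<close> is at most \<open>(2\<delta>)\<^sup>1\<^sup>/\<^sup>2\<close>, so the error terms disappear and \<open>Nbar f\<close>
  tends to a constant times the integral of \<open>\<bar>FT D\<bar>\<^sup>2\<close> over a half line. As \<open>D\<close> is real, \<open>\<bar>FT D\<bar>\<^sup>2\<close> is even, and as it
  is also uniformly small, that integral tends to half of the total mass given by Plancherel, wherever the half line starts.
  This is the origin of the factor \<open>1/2\<close>.\<close>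

section \<open>Gaussian summation, Fourier inversion and Plancherel\<close>

text \<open>The Beta integral at the exponents \<i>(p + k) and -\<i>p has an integrand of modulus
  one, so the p and y integrations cannot be exchanged as they stand. This forces a damping, removed
  only after the exchange. The variable s suits the errors because dk / (2k) becomes ds / 2: kernel
  errors of size exp (-|s|) are square integrable and are multiplied by the L1 norm of D. Replacing
  sqrt (2p) A(p) by its value c0 at p_o produces an error without decay in s; it is small in L2 by
  Plancherel and the continuity of A. Constants: 1/2 from dk / (2k), 1 / (2 pi)^2 from the squared
  Fourier prefactors, pi as half of the Plancherel mass 2 pi, and |c0|^2 = 4 pi / (exp (2 pi p_o) -
  1). Their product is the claimed limit. The packet position y_o enters only through the start of
  the half line, so the limit is the same for every y_o.\<close>

lemma borel_measurable_cis [measurable]: "cis \<in> borel_measurable borel"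
  by (intro borel_measurable_continuous_onI continuous_intros)

lemma borel_measurable_cnj [measurable]: "cnj \<in> borel_measurable borel"
  by (intro borel_measurable_continuous_onI continuous_intros)

text \<open>The measure dk / k on the half line is Lebesgue measure in s = ln k. Substitution is
  done on [-n, n], and monotone convergence on both sides gives the whole line. It serves
  \<open>Nbar\<close>, whose weight is 1 / (2k), and Euler's integral.\<close>

lemma nn_integral_ln_substitution:
  fixes h :: "real \<Rightarrow> real"
  assumes [measurable]: "h \<in> borel_measurable borel" and nonneg: "\<And>s. 0 \<le> h s"
  shows "(\<integral>\<^sup>+k. ennreal (h (ln k) / k) * indicator {0<..} k \<partial>lborel) = (\<integral>\<^sup>+s. ennreal (h s) \<partial>lborel)"
proof -
  have sub: "(\<integral>\<^sup>+k. ennreal (h (ln k) / k) * indicator {exp (- real n)..exp (real n)} k \<partial>lborel)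
      = (\<integral>\<^sup>+s. ennreal (h s) * indicator {- real n..real n} s \<partial>lborel)" for n
  proof -
    have "(\<integral>\<^sup>+k. ennreal (h (ln k) / k) * indicator {exp (- real n)..exp (real n)} k \<partial>lborel)
      = (\<integral>\<^sup>+s. ennreal (h (ln (exp s)) / exp s * exp s) * indicator {- real n..real n} s \<partial>lborel)"
    proof -
      have "(\<integral>\<^sup>+k. ennreal (h (ln k) / k * indicator {exp (- real n)..exp (real n)} k) \<partial>lborel)
        = (\<integral>\<^sup>+s. ennreal (h (ln (exp s)) / exp s * exp s * indicator {- real n..real n} s) \<partial>lborel)"
        by (rule nn_integral_substitution[where g=exp and g'=exp])
           (auto intro!: continuous_intros derivative_eq_intros simp: set_borel_measurable_def)
      then show ?thesis by (simp only: ennreal_mult'' ennreal_indicator indicator_pos_le)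
    qed
    then show ?thesis by simp
  qed
  have "(\<lambda>n. \<integral>\<^sup>+k. ennreal (h (ln k) / k) * indicator {exp (- real n)..exp (real n)} k \<partial>lborel)
     \<longlonglongrightarrow> (\<integral>\<^sup>+k. ennreal (h (ln k) / k) * indicator {0<..} k \<partial>lborel)"
  proof (rule nn_integral_LIMSEQ)
    show "incseq (\<lambda>n k. ennreal (h (ln k) / k) * indicator {exp (- real n)..exp (real n)} k)"
      by (auto simp: incseq_def le_fun_def split: split_indicator intro: order_trans) 
        (meson exp_le_cancel_iff neg_le_iff_le of_nat_le_iff order_trans)+
    show "(\<lambda>n. ennreal (h (ln k) / k) * indicator {exp (- real n)..exp (real n)} k)
       \<longlonglongrightarrow> ennreal (h (ln k) / k) * indicator {0<..} k" for k
    proof (cases "k > 0")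
      case True
      obtain N where N: "\<bar>ln k\<bar> \<le> real N" using real_arch_simple by blast
      have "\<forall>\<^sub>F n in sequentially. ennreal (h (ln k) / k) * indicator {exp (- real n)..exp (real n)} k
        = ennreal (h (ln k) / k) * indicator {0<..} k"
        using eventually_ge_at_top[of N]
      proof eventually_elim
        case (elim n)
        then have "- real n \<le> ln k" "ln k \<le> real n" using N by auto
        then have "exp (- real n) \<le> k" "k \<le> exp (real n)" using True
          by (metis exp_le_cancel_iff exp_ln)+
        then show ?case using True by simp
      qed
      then show ?thesis by (rule tendsto_eventually)
    next
      case False
      then have "k \<notin> {exp (- real n)..exp (real n)}" for n
        using exp_gt_zero[of "- real n"] by (auto simp del: exp_gt_zero)
      then show ?thesis using False by simp
    qed
  qed simp_all
  moreover have "(\<lambda>n. \<integral>\<^sup>+s. ennreal (h s) * indicator {- real n..real n} s \<partial>lborel)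
     \<longlonglongrightarrow> (\<integral>\<^sup>+s. ennreal (h s) \<partial>lborel)"
  proof (rule nn_integral_LIMSEQ)
    show "incseq (\<lambda>n s. ennreal (h s) * indicator {- real n..real n} s)"
      by (auto simp: incseq_def le_fun_def split: split_indicator)
    show "(\<lambda>n. ennreal (h s) * indicator {- real n..real n} s) \<longlonglongrightarrow> ennreal (h s)" for s
    proof -
      obtain N where N: "\<bar>s\<bar> \<le> real N" using real_arch_simple by blast
      have "\<forall>\<^sub>F n in sequentially. ennreal (h s) * indicator {- real n..real n} s = ennreal (h s)"
        using eventually_ge_at_top[of N] by eventually_elim (use N in \<open>auto simp: indicator_def\<close>)
      then show ?thesis by (rule tendsto_eventually)
    qed
  qed simp_all
  ultimately show ?thesis unfolding sub by (rule LIMSEQ_unique)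
qed

text \<open>As the kernel has modulus at most one, the product of |A s| and |B p| is an integrable
  majorant for Fubini. The kernels inserted later are phases in s * p.\<close>

lemma integral_kernel_swap:
  fixes A B :: "real \<Rightarrow> complex" and K :: "real \<Rightarrow> real \<Rightarrow> complex"
  assumes A: "integrable lborel A" and B: "integrable lborel B"
    and K[measurable]: "(\<lambda>(s,p). K s p) \<in> borel_measurable (borel \<Otimes>\<^sub>M borel)"
    and K1: "\<And>s p. cmod (K s p) \<le> 1"
  shows "(LINT s|lborel. A s * (LINT p|lborel. B p * K s p)) = (LINT p|lborel. B p * (LINT s|lborel. A s * K s p))"
proof -
  note [measurable] = borel_measurable_integrable[OF A] borel_measurable_integrable[OF B]
  have AB: "integrable (lborel \<Otimes>\<^sub>M lborel) (\<lambda>(s,p). A s * B p)"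
  proof (rule lborel_pair.Fubini_integrable)
    show "integrable lborel (\<lambda>s. LINT p|lborel. norm (case (s, p) of (s, p) \<Rightarrow> A s * B p))"
      using A by (simp add: norm_mult)
    show "AE s in lborel. integrable lborel (\<lambda>p. case (s, p) of (s, p) \<Rightarrow> A s * B p)"
      using B by simp
  qed simp
  have "integrable (lborel \<Otimes>\<^sub>M lborel) (\<lambda>(s,p). A s * B p * K s p)"
    by (rule Bochner_Integration.integrable_bound[OF AB])
       (auto simp: norm_mult intro!: AE_I2 mult_right_le_one_le K1)
  from lborel_pair.Fubini_integral[OF this]
  have "(LINT s|lborel. LINT p|lborel. A s * B p * K s p) = (LINT p|lborel. LINT s|lborel. A s * B p * K s p)"
    by simp
  moreover have "(LINT p|lborel. A s * B p * K s p) = A s * (LINT p|lborel. B p * K s p)" for s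
    by (simp add: mult.assoc)
  moreover have "(LINT s|lborel. A s * B p * K s p) = B p * (LINT s|lborel. A s * K s p)" for p
    unfolding integral_mult_right_zero[symmetric] by (simp add: mult_ac)
  ultimately show ?thesis by simp
qed

text \<open>A rescaled characteristic function of the standard normal law: a Gaussian weight of
  width 1 / \<sigma> transforms into 2 pi times a probability density of width \<sigma>, an
  approximate identity as \<sigma> tends to 0.\<close>

lemma gaussian_fourier:
  assumes "\<sigma> > 0"
  shows "(LINT s|lborel. complex_of_real (exp (- (\<sigma> * s)\<^sup>2 / 2)) * cis (s * t))
     = complex_of_real (2 * pi * normal_density 0 \<sigma> t)"
proof -
  have 1: "(LINT s|lborel. complex_of_real (std_normal_density s) * cis (u * s)) = complex_of_real (exp (- (u\<^sup>2) / 2))" for u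
  proof -
    have "char std_normal_distribution u = complex_of_real (exp (- (u\<^sup>2) / 2))"
      by (simp add: char_std_normal_distribution)
    then show ?thesis unfolding char_def
      by (subst (asm) integral_density) (auto simp: scaleR_conv_of_real cis_conv_exp)
  qed
  have "(LINT s|lborel. complex_of_real (std_normal_density s) * cis (t / \<sigma> * s))
     = \<bar>\<sigma>\<bar> *\<^sub>R (LINT s|lborel. complex_of_real (std_normal_density (0 + \<sigma> * s)) * cis (t / \<sigma> * (0 + \<sigma> * s)))"
    using assms by (intro lborel_integral_real_affine) simp
  also have "\<dots> = \<sigma> *\<^sub>R (LINT s|lborel. complex_of_real (1 / sqrt (2*pi)) * (complex_of_real (exp (- (\<sigma> * s)\<^sup>2 / 2)) * cis (s * t)))"
    using assms by (simp add: std_normal_density_def mult_ac)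
  also have "\<dots> = complex_of_real (\<sigma> / sqrt (2*pi)) * (LINT s|lborel. complex_of_real (exp (- (\<sigma> * s)\<^sup>2 / 2)) * cis (s * t))"
    unfolding integral_mult_right_zero by (simp add: scaleR_conv_of_real)
  finally have 2: "complex_of_real (exp (- ((t/\<sigma>)\<^sup>2) / 2)) = complex_of_real (\<sigma> / sqrt (2*pi)) * (LINT s|lborel. complex_of_real (exp (- (\<sigma> * s)\<^sup>2 / 2)) * cis (s * t))"
    unfolding 1 .
  have s: "sqrt (2*pi) * sqrt (2 * pi) = 2 * pi" by simp
  have "2 * pi * normal_density 0 \<sigma> t = sqrt (2*pi) / \<sigma> * exp (- ((t/\<sigma>)\<^sup>2) / 2)"
    using assms s by (simp add: normal_density_def real_sqrt_mult field_simps)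
  then have "complex_of_real (2 * pi * normal_density 0 \<sigma> t) = complex_of_real (sqrt (2*pi) / \<sigma>) * complex_of_real (exp (- ((t/\<sigma>)\<^sup>2) / 2))"
    by (metis of_real_mult)
  then show ?thesis unfolding 2 using assms by simp
qed

lemma integrable_gaussian:
  assumes "\<sigma> > 0"
  shows "integrable lborel (\<lambda>s. exp (- (\<sigma> * s)\<^sup>2 / 2) :: real)"
proof -
  have "integrable lborel (\<lambda>s. sqrt (2*pi) * std_normal_density (0 + \<sigma> * s))"
    by (intro integrable_mult_right lborel_integrable_real_affine) (use assms in auto)
  then show ?thesis by (simp add: std_normal_density_def)
qed

text \<open>Moves \<sigma> into the argument of \<open>G\<close> and leaves the density fixed, so
  that the limit \<sigma> -> 0 has a majorant free of \<sigma>.\<close>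

lemma integral_normal_density_affine:
  fixes G :: "real \<Rightarrow> complex"
  assumes "\<sigma> > 0"
  shows "(LINT q|lborel. complex_of_real (normal_density 0 \<sigma> (q - p)) * G q)
    = (LINT z|lborel. complex_of_real (std_normal_density z) * G (p + \<sigma> * z))"
proof -
  have nd: "\<sigma> * normal_density 0 \<sigma> (\<sigma> * z) = std_normal_density z" for z
    using assms by (simp add: normal_density_def real_sqrt_mult power_mult_distrib)
  have "(LINT q|lborel. complex_of_real (normal_density 0 \<sigma> (q - p)) * G q)
    = \<sigma> *\<^sub>R (LINT z|lborel. complex_of_real (normal_density 0 \<sigma> (\<sigma> * z)) * G (p + \<sigma> * z))"
    by (subst lborel_integral_real_affine[of \<sigma> _ p]) (use assms in auto)
  also have "\<dots> = (LINT z|lborel. complex_of_real (std_normal_density z) * G (p + \<sigma> * z))"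
    unfolding integral_scaleR_right[symmetric] nd[symmetric]
    by (simp add: scaleR_conv_of_real mult_ac)
  finally show ?thesis .
qed

lemma std_normal_average_bound:
  fixes G :: "real \<Rightarrow> complex"
  assumes [measurable]: "G \<in> borel_measurable borel" and B: "\<And>x. cmod (G x) \<le> B"
  shows "cmod (LINT z|lborel. complex_of_real (std_normal_density z) * G (p + \<sigma> * z)) \<le> B"
proof -
  have "cmod (LINT z|lborel. complex_of_real (std_normal_density z) * G (p + \<sigma> * z)) \<le> (LINT z|lborel. std_normal_density z * B)"
  proof (rule Bochner_Integration.integral_norm_bound_integral)
    show le: "norm (complex_of_real (std_normal_density z) * G (p + \<sigma> * z)) \<le> std_normal_density z * B" for z
      by (auto simp: norm_mult intro!: mult_left_mono B)
    show "integrable lborel (\<lambda>z. complex_of_real (std_normal_density z) * G (p + \<sigma> * z))"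
      by (rule Bochner_Integration.integrable_bound[of lborel "\<lambda>z. std_normal_density z * B"])
         (auto intro!: AE_I2 order_trans[OF le])
  qed simp
  then show ?thesis by simp
qed

lemma gaussian_approx_identity:
  fixes G :: "real \<Rightarrow> complex"
  assumes cont: "continuous_on UNIV G" and B: "\<And>x. cmod (G x) \<le> B"
  shows "(\<lambda>n. LINT z|lborel. complex_of_real (std_normal_density z) * G (p + 1 / real (Suc n) * z)) \<longlonglongrightarrow> G p"
proof -
  have [measurable]: "G \<in> borel_measurable borel" using cont by (rule borel_measurable_continuous_onI)
  have "(\<lambda>n. LINT z|lborel. complex_of_real (std_normal_density z) * G (p + 1 / real (Suc n) * z))
     \<longlonglongrightarrow> (LINT z|lborel. complex_of_real (std_normal_density z) * G p)"
  proof (rule integral_dominated_convergence[where w="\<lambda>z. std_normal_density z * B"])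
    show "AE z in lborel. (\<lambda>n. complex_of_real (std_normal_density z) * G (p + 1 / real (Suc n) * z))
       \<longlonglongrightarrow> complex_of_real (std_normal_density z) * G p"
    proof (intro AE_I2 tendsto_mult tendsto_const)
      fix z
      have "(\<lambda>n. p + 1 / real (Suc n) * z) \<longlonglongrightarrow> p + 0 * z"
        by (intro tendsto_intros LIMSEQ_Suc lim_1_over_n)
      moreover have "isCont G p" using cont by (simp add: continuous_on_eq_continuous_at)
      ultimately show "(\<lambda>n. G (p + 1 / real (Suc n) * z)) \<longlonglongrightarrow> G p"
        by (intro isCont_tendsto_compose[of p G]) simp_all
    qed
  qed (auto simp: norm_mult intro!: mult_left_mono B)
  then show ?thesis by (simp add: integral_complex_of_real)
qed

text \<open>The Gaussian weight makes the double integral absolutely convergent. After the exchange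
  the inner integral is the transform of the weight, centred at q, so damped inversion is a
  smoothing of \<open>G\<close>.\<close>

lemma gaussian_fourier_inversion:
  fixes G :: "real \<Rightarrow> complex"
  assumes G: "integrable lborel G" and \<sigma>: "\<sigma> > 0"
  shows "(LINT s|lborel. complex_of_real (exp (- (\<sigma> * s)\<^sup>2 / 2)) * (LINT p|lborel. G p * cis (s * p)) * cis (- (s * q)))
    = complex_of_real (2 * pi) * (LINT z|lborel. complex_of_real (std_normal_density z) * G (q + \<sigma> * z))"
proof -
  have W: "integrable lborel (\<lambda>s. complex_of_real (exp (- (\<sigma> * s)\<^sup>2 / 2)) * cis (- (s * q)))"
    by (rule Bochner_Integration.integrable_bound[OF integrable_gaussian[OF \<sigma>]]) (auto simp: norm_mult)
  have "(LINT s|lborel. complex_of_real (exp (- (\<sigma> * s)\<^sup>2 / 2)) * (LINT p|lborel. G p * cis (s * p)) * cis (- (s * q)))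
    = (LINT s|lborel. (complex_of_real (exp (- (\<sigma> * s)\<^sup>2 / 2)) * cis (- (s * q))) * (LINT p|lborel. G p * cis (s * p)))"
    by (simp add: mult_ac)
  also have "\<dots> = (LINT p|lborel. G p * (LINT s|lborel. (complex_of_real (exp (- (\<sigma> * s)\<^sup>2 / 2)) * cis (- (s * q))) * cis (s * p)))"
    by (rule integral_kernel_swap[OF W G]) auto
  also have "\<dots> = (LINT p|lborel. G p * complex_of_real (2 * pi * normal_density 0 \<sigma> (p - q)))"
  proof -
    have "(LINT s|lborel. (complex_of_real (exp (- (\<sigma> * s)\<^sup>2 / 2)) * cis (- (s * q))) * cis (s * p))
      = complex_of_real (2 * pi * normal_density 0 \<sigma> (p - q))" for p
      unfolding gaussian_fourier[OF \<sigma>, symmetric] by (simp add: mult.assoc cis_mult right_diff_distrib)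
    then show ?thesis by simp
  qed
  also have "\<dots> = (LINT p|lborel. complex_of_real (2 * pi) * (complex_of_real (normal_density 0 \<sigma> (p - q)) * G p))"
    by (simp add: mult_ac)
  also have "\<dots> = complex_of_real (2 * pi) * (LINT z|lborel. complex_of_real (std_normal_density z) * G (q + \<sigma> * z))"
    unfolding integral_mult_right_zero integral_normal_density_affine[OF \<sigma>] ..
  finally show ?thesis .
qed

text \<open>The damping is removed along \<sigma> = 1 / (n + 1): the modulus of the transform is the
  majorant on one side, and on the other the smoothed \<open>G\<close> tends to \<open>G q\<close>
  by continuity.\<close>

lemma fourier_inversion:
  fixes G :: "real \<Rightarrow> complex"
  assumes G: "integrable lborel G" and cont: "continuous_on UNIV G" and B: "\<And>x. cmod (G x) \<le> B"
    and F: "integrable lborel (\<lambda>s. LINT p|lborel. G p * cis (s * p))"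
  shows "(LINT s|lborel. (LINT p|lborel. G p * cis (s * p)) * cis (- (s * q))) = complex_of_real (2 * pi) * G q"
proof -
  note [measurable] = borel_measurable_integrable[OF F]
  have "(\<lambda>n. LINT s|lborel. complex_of_real (exp (- (1 / real (Suc n) * s)\<^sup>2 / 2)) * (LINT p|lborel. G p * cis (s * p)) * cis (- (s * q)))
     \<longlonglongrightarrow> (LINT s|lborel. (LINT p|lborel. G p * cis (s * p)) * cis (- (s * q)))"
  proof (rule integral_dominated_convergence[where w="\<lambda>s. cmod (LINT p|lborel. G p * cis (s * p))"])
    show "AE s in lborel. (\<lambda>n. complex_of_real (exp (- (1 / real (Suc n) * s)\<^sup>2 / 2)) * (LINT p|lborel. G p * cis (s * p)) * cis (- (s * q)))
       \<longlonglongrightarrow> (LINT p|lborel. G p * cis (s * p)) * cis (- (s * q))"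
    proof (rule AE_I2)
      fix s
      have "(\<lambda>n. complex_of_real (exp (- (1 / real (Suc n) * s)\<^sup>2 / 2)) * (LINT p|lborel. G p * cis (s * p)) * cis (- (s * q)))
        \<longlonglongrightarrow> complex_of_real (exp (- (0 * s)\<^sup>2 / 2)) * (LINT p|lborel. G p * cis (s * p)) * cis (- (s * q))"
        by (intro tendsto_intros LIMSEQ_Suc lim_1_over_n) auto
      then show "(\<lambda>n. complex_of_real (exp (- (1 / real (Suc n) * s)\<^sup>2 / 2)) * (LINT p|lborel. G p * cis (s * p)) * cis (- (s * q)))
       \<longlonglongrightarrow> (LINT p|lborel. G p * cis (s * p)) * cis (- (s * q))" by simp
    qed
  qed (use F in \<open>auto simp: norm_mult intro!: mult_left_le_one_le\<close>)
  moreover have "(\<lambda>n. LINT s|lborel. complex_of_real (exp (- (1 / real (Suc n) * s)\<^sup>2 / 2)) * (LINT p|lborel. G p * cis (s * p)) * cis (- (s * q)))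
     \<longlonglongrightarrow> complex_of_real (2 * pi) * G q"
    \<comment> \<open>The chained rule proves the side condition 0 < 1 / (n + 1).\<close>
    unfolding gaussian_fourier_inversion[OF G zero_less_divide_1_iff[THEN iffD2, OF of_nat_0_less_iff[THEN iffD2, OF zero_less_Suc]]]
    by (intro tendsto_intros gaussian_approx_identity[OF cont B])
  ultimately show ?thesis by (rule LIMSEQ_unique)
qed

text \<open>Square integrability of the transform is part of the conclusion, hence the
  \<open>ennreal\<close> integral. With a Gaussian weight all integrals exist, and the exchange
  gives 2 pi times the pairing of \<open>G\<close> with its smoothing. The weights increase to 1, so
  monotone convergence applies to the transform and dominated convergence to the pairing.\<close>

lemma plancherel:
  fixes G :: "real \<Rightarrow> complex"
  assumes G: "integrable lborel G" and cont: "continuous_on UNIV G" and B: "\<And>x. cmod (G x) \<le> B"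
  shows "(\<integral>\<^sup>+s. ennreal ((cmod (LINT p|lborel. G p * cis (s * p)))\<^sup>2) \<partial>lborel)
    = ennreal (2 * pi * (LINT p|lborel. (cmod (G p))\<^sup>2))"
proof -
  have [measurable]: "G \<in> borel_measurable borel" using cont by (rule borel_measurable_continuous_onI)
  define F where "F s = (LINT p|lborel. G p * cis (s * p))" for s
  have [measurable]: "F \<in> borel_measurable borel" unfolding F_def by measurable
  define W where "W n s = exp (- (1 / real (Suc n) * s)\<^sup>2 / 2)" for n :: nat and s :: real
  have [measurable]: "W n \<in> borel_measurable borel" for n unfolding W_def by measurable
  define S where "S n q = (LINT z|lborel. complex_of_real (std_normal_density z) * G (q + 1 / real (Suc n) * z))" for n q
  have [measurable]: "S n \<in> borel_measurable borel" for n unfolding S_def by measurable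
  have W0: "0 \<le> W n s" "W n s \<le> 1" for n s by (auto simp: W_def)
  have Wint: "integrable lborel (W n)" for n
    unfolding W_def by (rule integrable_gaussian) simp
  define C where "C = (LINT p|lborel. cmod (G p))"
  have FC: "cmod (F s) \<le> C" for s
    unfolding F_def C_def using integral_norm_bound[of lborel "\<lambda>p. G p * cis (s * p)"] by (simp add: norm_mult)
  have C0: "0 \<le> C" unfolding C_def by simp
  have WF: "integrable lborel (\<lambda>s. complex_of_real (W n s) * F s)" for n
    by (rule Bochner_Integration.integrable_bound[of lborel "\<lambda>s. W n s * C"])
       (use Wint C0 W0 in \<open>auto simp: norm_mult intro!: mult_left_mono FC\<close>)
  have WFF: "integrable lborel (\<lambda>s. W n s * (cmod (F s))\<^sup>2)" for n
    by (rule Bochner_Integration.integrable_bound[of lborel "\<lambda>s. W n s * C\<^sup>2"])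
       (use Wint C0 W0 in \<open>auto simp: norm_mult intro!: mult_left_mono power_mono FC\<close>)
  have cG: "integrable lborel (\<lambda>q. cnj (G q))" using G by simp
  have cnjF: "cnj (F s) = (LINT q|lborel. cnj (G q) * cis (- (s * q)))" for s
    unfolding F_def using Bochner_Integration.integral_cnj[of lborel "\<lambda>p. G p * cis (s * p)"] by (simp add: cis_cnj)
  have I: "complex_of_real (LINT s|lborel. W n s * (cmod (F s))\<^sup>2) = complex_of_real (2 * pi) * (LINT q|lborel. cnj (G q) * S n q)" for n
  proof -
    have "complex_of_real (LINT s|lborel. W n s * (cmod (F s))\<^sup>2) = (LINT s|lborel. (complex_of_real (W n s) * F s) * cnj (F s))"
    proof -
      have "complex_of_real (W n s * (cmod (F s))\<^sup>2) = (complex_of_real (W n s) * F s) * cnj (F s)" for s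
        unfolding of_real_mult complex_norm_square by (simp add: mult_ac)
      then show ?thesis by (simp only: integral_complex_of_real[symmetric])
    qed
    also have "\<dots> = (LINT s|lborel. (complex_of_real (W n s) * F s) * (LINT q|lborel. cnj (G q) * cis (- (s * q))))"
      unfolding cnjF ..
    also have "\<dots> = (LINT q|lborel. cnj (G q) * (LINT s|lborel. (complex_of_real (W n s) * F s) * cis (- (s * q))))"
      by (rule integral_kernel_swap[OF WF cG]) auto
    also have "(\<lambda>q. LINT s|lborel. (complex_of_real (W n s) * F s) * cis (- (s * q))) = (\<lambda>q. complex_of_real (2 * pi) * S n q)"
      unfolding W_def F_def S_def by (intro ext gaussian_fourier_inversion G) simp
    also have "(LINT q|lborel. cnj (G q) * (complex_of_real (2 * pi) * S n q)) = (LINT q|lborel. complex_of_real (2 * pi) * (cnj (G q) * S n q))"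
      by (simp add: mult_ac)
    finally show ?thesis unfolding integral_mult_right_zero .
  qed
  have "(\<lambda>n. LINT q|lborel. cnj (G q) * S n q) \<longlonglongrightarrow> (LINT q|lborel. cnj (G q) * G q)"
  proof (rule integral_dominated_convergence[where w="\<lambda>q. cmod (G q) * B"])
    show "AE q in lborel. (\<lambda>n. cnj (G q) * S n q) \<longlonglongrightarrow> cnj (G q) * G q"
      unfolding S_def by (intro AE_I2 tendsto_intros gaussian_approx_identity[OF cont B])
    show "AE q in lborel. norm (cnj (G q) * S n q) \<le> cmod (G q) * B" for n
      unfolding S_def norm_mult by (intro AE_I2 mult_mono std_normal_average_bound B) auto
  qed (use G in auto)
  then have "(\<lambda>n. complex_of_real (LINT s|lborel. W n s * (cmod (F s))\<^sup>2)) \<longlonglongrightarrow> complex_of_real (2 * pi) * (LINT q|lborel. cnj (G q) * G q)"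
    unfolding I by (intro tendsto_intros)
  also have "(LINT q|lborel. cnj (G q) * G q) = complex_of_real (LINT q|lborel. (cmod (G q))\<^sup>2)"
    unfolding integral_complex_of_real[symmetric] complex_norm_square by (simp add: mult.commute)
  finally have lim: "(\<lambda>n. LINT s|lborel. W n s * (cmod (F s))\<^sup>2) \<longlonglongrightarrow> 2 * pi * (LINT q|lborel. (cmod (G q))\<^sup>2)"
    by (simp only: of_real_mult[symmetric] tendsto_of_real_iff)
  have "(\<lambda>n. \<integral>\<^sup>+s. ennreal (W n s * (cmod (F s))\<^sup>2) \<partial>lborel) \<longlonglongrightarrow> (\<integral>\<^sup>+s. ennreal ((cmod (F s))\<^sup>2) \<partial>lborel)"
  proof (rule nn_integral_LIMSEQ)
    have "W m s \<le> W n s" if "m \<le> n" for m n s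
      unfolding W_def using that
      by (simp add: power_mult_distrib power_divide divide_simps) (intro mult_left_mono power_mono; simp)
    then show "incseq (\<lambda>n s. ennreal (W n s * (cmod (F s))\<^sup>2))"
      by (auto simp: incseq_def le_fun_def intro!: ennreal_leI mult_right_mono)
    show "(\<lambda>n. ennreal (W n s * (cmod (F s))\<^sup>2)) \<longlonglongrightarrow> ennreal ((cmod (F s))\<^sup>2)" for s
    proof -
      have "(\<lambda>n. W n s * (cmod (F s))\<^sup>2) \<longlonglongrightarrow> exp (- (0 * s)\<^sup>2 / 2) * (cmod (F s))\<^sup>2"
        unfolding W_def by (intro tendsto_intros LIMSEQ_Suc lim_1_over_n) auto
      then show ?thesis by (intro tendsto_ennrealI) simp
    qed
  qed simp
  moreover have "(\<integral>\<^sup>+s. ennreal (W n s * (cmod (F s))\<^sup>2) \<partial>lborel) = ennreal (LINT s|lborel. W n s * (cmod (F s))\<^sup>2)" for n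
    by (rule nn_integral_eq_integral[OF WFF]) (use W0 in auto)
  ultimately have "(\<lambda>n. ennreal (LINT s|lborel. W n s * (cmod (F s))\<^sup>2)) \<longlonglongrightarrow> (\<integral>\<^sup>+s. ennreal ((cmod (F s))\<^sup>2) \<partial>lborel)"
    by simp
  then show ?thesis using LIMSEQ_unique[OF _ tendsto_ennrealI[OF lim]] unfolding F_def by blast
qed

section \<open>The Beta integral on the line\<close>

text \<open>With k = exp t the modulus becomes the integrand of Euler's integral at the real number
  Re a.\<close>

lemma integrable_exp_minus_exp:
  fixes a :: complex
  assumes "Re a > 0"
  shows "integrable lborel (\<lambda>t. exp (a * complex_of_real t - complex_of_real (exp t)))"
proof (rule integrableI_bounded)
  have "(\<integral>\<^sup>+t. ennreal (norm (exp (a * complex_of_real t - complex_of_real (exp t)))) \<partial>lborel)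
    = (\<integral>\<^sup>+t. ennreal (exp (Re a * t - exp t)) \<partial>lborel)"
    by simp
  also have "\<dots> = (\<integral>\<^sup>+k. ennreal (exp (Re a * ln k - exp (ln k)) / k) * indicator {0<..} k \<partial>lborel)"
    by (rule nn_integral_ln_substitution[symmetric]) auto
  also have "\<dots> \<le> (\<integral>\<^sup>+k. ennreal (indicator {0..} k * k powr (Re a - 1) / exp k) \<partial>lborel)"
    by (intro nn_integral_mono) (auto simp: indicator_def powr_def exp_diff exp_minus field_simps intro!: ennreal_leI)
  also have "\<dots> < \<infinity>"
    using Gamma_conv_nn_integral_real[of "Re a"] assms by (metis ennreal_less_top infinity_ennreal_def)
  finally show "(\<integral>\<^sup>+t. ennreal (norm (exp (a * complex_of_real t - complex_of_real (exp t)))) \<partial>lborel) < \<infinity>" .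
qed simp

lemma integral_exp_minus_exp:
  fixes a :: complex
  assumes a: "Re a > 0"
  shows "(LINT t|lborel. exp (a * complex_of_real t - complex_of_real (exp t))) = Gamma a"
proof -
  define f where "f k = complex_of_real k powr (a - 1) / complex_of_real (exp k)" for k
  have fexp: "exp x *\<^sub>R f (exp x) = exp (a * complex_of_real x - complex_of_real (exp x))" for x
    unfolding f_def powr_def
    by (simp add: Ln_of_real exp_diff scaleR_conv_of_real exp_of_real ring_distribs)
  have UN: "einterval (-\<infinity>) \<infinity> = UNIV" by (auto simp: einterval_def)
  have PO: "einterval 0 \<infinity> = {0<..}" by (auto simp: einterval_def zero_ereal_def)
  have contf: "continuous_on {0<..} f"
    unfolding f_def by (intro continuous_intros) (auto simp: complex_nonpos_Reals_iff)
  have abs: "f absolutely_integrable_on {0<..}"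
    unfolding f_def[abs_def] by (rule absolutely_integrable_Gamma_integral'[OF a])
  \<comment> \<open>\<open>f\<close> is Borel on the half line, so absolute integrability for the
    completed measure descends to \<open>lborel\<close>.\<close>
  have int: "set_integrable lborel {0<..} f"
  proof -
    have "(\<lambda>x. indicator {0<..} x *\<^sub>R f x) \<in> borel_measurable borel"
      by (rule borel_measurable_continuous_on_indicator[OF _ contf]) simp
    then show ?thesis using abs unfolding set_integrable_def
      by (subst (asm) integrable_completion) auto
  qed
  have "(LBINT x=0..\<infinity>. f x) = (LBINT x=-\<infinity>..\<infinity>. exp x *\<^sub>R f (exp x))"
  proof (rule interval_integral_substitution_integrable)
    show "isCont f (exp x)" for x using contf by (simp add: continuous_on_eq_continuous_at)
    show "((ereal \<circ> exp \<circ> real_of_ereal) \<longlongrightarrow> 0) (at_right (- \<infinity>))"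
      unfolding ereal_tendsto_simps1 zero_ereal_def ereal_tendsto_simps2 by (rule exp_at_bot)
    show "((ereal \<circ> exp \<circ> real_of_ereal) \<longlongrightarrow> \<infinity>) (at_left \<infinity>)"
      by (simp add: ereal_tendsto_simps1 ereal_tendsto_simps2 exp_at_top)
    show "set_integrable lborel (einterval (- \<infinity>) \<infinity>) (\<lambda>x. exp x *\<^sub>R f (exp x))"
      unfolding UN fexp set_integrable_def using integrable_exp_minus_exp[OF a] by simp
  qed (auto simp: PO int intro: derivative_eq_intros)
  then have "(LINT k:{0<..}|lborel. f k) = (LINT t|lborel. exp (a * complex_of_real t - complex_of_real (exp t)))"
    by (simp add: interval_lebesgue_integral_def UN PO fexp set_lebesgue_integral_def)
  also have "(LINT k:{0<..}|lborel. f k) = integral {0<..} f"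
    by (rule set_borel_integral_eq_integral(2)[OF int])
  also have "\<dots> = Gamma a"
    using Gamma_integral_complex'[OF a] unfolding f_def[abs_def] by (rule integral_unique)
  finally show ?thesis ..
qed

text \<open>Both Gamma factors are written as integrals of \<open>exp (a t - exp t)\<close> over the whole line, so that the usual
  substitution in the double integral reduces to two translations.\<close>

lemma Beta_exp_integral:
  fixes a b :: complex
  assumes a: "Re a > 0" and b: "Re b > 0"
  shows "integrable lborel (\<lambda>y. exp (a * complex_of_real y - (a + b) * complex_of_real (ln (1 + exp y))))" (is ?I)
    and "(LINT y|lborel. exp (a * complex_of_real y - (a + b) * complex_of_real (ln (1 + exp y)))) = Gamma a * Gamma b / Gamma (a + b)" (is ?E)
proof -
  define E where "E a t = exp (a * complex_of_real t - complex_of_real (exp t))" for a t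
  have Eint: "integrable lborel (E a)" "(LINT t|lborel. E a t) = Gamma a" if "Re a > 0" for a
    unfolding E_def[abs_def] using integrable_exp_minus_exp[OF that] integral_exp_minus_exp[OF that] by auto
  have sh: "integrable lborel (\<lambda>t. E a (c + t))" "(LINT t|lborel. E a (c + t)) = Gamma a" if "Re a > 0" for a c
    using lborel_integrable_real_affine[OF Eint(1)[OF that], of 1 c]
      lborel_integral_real_affine[of 1 "E a" c] Eint(2)[OF that] by auto
  have [measurable]: "E a \<in> borel_measurable borel" for a unfolding E_def[abs_def] by measurable
  define w where "w y = exp (a * complex_of_real y - (a + b) * complex_of_real (ln (1 + exp y)))" for y
  \<comment> \<open>exp t + exp (t + y) = exp (t + ln (1 + exp y)): the two double exponentials
    merge into one, and a translation of t separates the variables.\<close>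
  have key: "E b t * E a (t + y) = w y * E (a + b) (ln (1 + exp y) + t)" for t y
  proof -
    have "exp (ln (1 + exp y) + t) = exp t + exp (t + y)"
      by (subst exp_add, subst exp_ln) (simp_all add: add_pos_pos exp_add ring_distribs)
    then show ?thesis unfolding w_def E_def
      by (simp flip: exp_add) (simp add: algebra_simps)
  qed
  have int: "integrable (lborel \<Otimes>\<^sub>M lborel) (\<lambda>(t,y). E b t * E a (t + y))"
  proof (rule lborel_pair.Fubini_integrable)
    have "(LINT y|lborel. norm (E a (t + y))) = (LINT y|lborel. norm (E a y))" for t
      using lborel_integral_real_affine[of 1 "\<lambda>y. norm (E a y)" t] by simp
    then show "integrable lborel (\<lambda>t. LINT y|lborel. norm (case (t, y) of (t, y) \<Rightarrow> E b t * E a (t + y)))"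
      using Eint(1)[OF b] by (simp add: norm_mult)
    show "AE t in lborel. integrable lborel (\<lambda>y. case (t, y) of (t, y) \<Rightarrow> E b t * E a (t + y))"
      using sh(1)[OF a] by simp
  qed simp
  have ab: "Re (a + b) > 0" using a b by simp
  have inner: "(LINT t|lborel. E b t * E a (t + y)) = w y * Gamma (a + b)" for y
    unfolding key using sh(2)[OF ab] by simp
  \<comment> \<open>\<open>Gamma\<close> is 0 by convention exactly at its poles, which Re (a + b) >
    0 excludes.\<close>
  have G0: "Gamma (a + b) \<noteq> 0"
  proof
    assume "Gamma (a + b) = 0"
    then obtain n where "a + b = complex_of_int n" "n \<le> 0" by (auto simp: Gamma_eq_zero_iff nonpos_Ints_def)
    then show False using ab by simp
  qed
  have "(LINT t|lborel. LINT y|lborel. E b t * E a (t + y)) = Gamma b * Gamma a"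
    using sh(2)[OF a] Eint(2)[OF b] by simp
  moreover have "(LINT y|lborel. LINT t|lborel. E b t * E a (t + y)) = (LINT t|lborel. LINT y|lborel. E b t * E a (t + y))"
    using lborel_pair.Fubini_integral[OF int] by simp
  ultimately have "(LINT y|lborel. w y) * Gamma (a + b) = Gamma b * Gamma a"
    unfolding inner by simp
  then show ?E using G0 unfolding w_def by (simp add: field_simps)
  \<comment> \<open>Fubini also yields integrability in y of the inner integral, which is
    \<open>w y\<close> times a nonzero constant.\<close>
  have "integrable lborel (\<lambda>y. LINT t|lborel. E b t * E a (t + y))"
    using lborel_pair.integrable_snd[OF int] by simp
  then have "integrable lborel (\<lambda>y. w y * Gamma (a + b) * inverse (Gamma (a + b)))"
    unfolding inner by (rule integrable_mult_left)
  then show ?I unfolding w_def[symmetric] using G0 by (simp add: mult.assoc)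
qed

section \<open>Asymptotics of a quotient of Gamma functions\<close>

text \<open>Taylor expansion of Ln at w with step 1. The segment from w to w + 1 stays at height Im
  w, off the branch cut, and moves away from the origin, so the second derivative -1 / t^2 is
  largest in modulus at w.\<close>

lemma Ln_add_one_bound:
  assumes "Re w \<ge> 0" "Im w > 0"
  shows "cmod (Ln (w + 1) - Ln w - 1 / w) \<le> 1 / (cmod w)\<^sup>2"
proof -
  define f where "f i t = (if i = 0 then Ln t else if i = 1 then inverse t else - inverse (t\<^sup>2))" for i :: nat and t
  have seg: "Im t = Im w \<and> Re w \<le> Re t" if "t \<in> closed_segment w (w + 1)" for t
    using that by (auto simp: closed_segment_def algebra_simps)
  have "cmod (f 0 (w + 1) - (\<Sum>i\<le>1. f i w * ((w + 1) - w) ^ i / (fact i))) \<le> 1 / (cmod w)\<^sup>2 * cmod ((w + 1) - w)^(Suc 1) / fact 1"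
  proof (rule complex_Taylor[of "closed_segment w (w + 1)"])
    fix i :: nat and t assume t: "t \<in> closed_segment w (w + 1)" and i: "i \<le> 1"
    have t0: "t \<noteq> 0" "t \<notin> \<real>\<^sub>\<le>\<^sub>0" using seg[OF t] assms by (auto simp: complex_nonpos_Reals_iff)
    then show "(f i has_field_derivative f (Suc i) t) (at t within closed_segment w (w + 1))"
      using i unfolding f_def
      by (cases i) (auto intro!: derivative_eq_intros simp: power2_eq_square)
  next
    fix t assume t: "t \<in> closed_segment w (w + 1)"
    have "cmod w \<le> cmod t"
      using seg[OF t] assms unfolding cmod_def by (intro real_sqrt_le_mono add_mono power_mono) auto
    then have "1 / (cmod t)\<^sup>2 \<le> 1 / (cmod w)\<^sup>2"
      using assms by (intro divide_left_mono power_mono mult_pos_pos) (use seg[OF t] in \<open>auto simp: complex_eq_iff\<close>)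
    then show "cmod (f (Suc 1) t) \<le> 1 / (cmod w)\<^sup>2"
      by (simp add: f_def norm_inverse norm_power norm_divide inverse_eq_divide)
  qed auto
  then show ?thesis by (simp add: f_def inverse_eq_divide algebra_simps)
qed

text \<open>Telescoping: 1 / (x + 1)^2 is at most 1 / x - 1 / (x + 1). The induction carries the
  extra term -1 / (k + n). Of the 2 / k, one half pays for j = 0, where k \<ge> 1 enters, and the
  other for the tail.\<close>

lemma sum_inverse_squares_bound:
  fixes k :: real
  assumes "k \<ge> 1"
  shows "(\<Sum>j\<le>n. 1 / (k + real j)\<^sup>2) \<le> 2 / k"
proof -
  have "(\<Sum>j\<le>n. 1 / (k + real j)\<^sup>2) \<le> 2 / k - 1 / (k + real n)"
  proof (induction n)
    case 0
    have "1 / k\<^sup>2 \<le> 1 / k" using assms by (simp add: power2_eq_square divide_simps)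
    then show ?case by simp
  next
    case (Suc n)
    have "1 / (k + real (Suc n))\<^sup>2 \<le> 1 / (k + real n) - 1 / (k + real (Suc n))"
    proof -
      define x where "x = k + real n"
      have x: "x > 0" using assms by (simp add: x_def)
      have "1 / (x + 1)\<^sup>2 \<le> 1 / (x * (x + 1))"
        using x by (intro divide_left_mono) (auto simp: power2_eq_square)
      also have "\<dots> = 1 / x - 1 / (x + 1)" using x by (simp add: field_simps)
      finally show ?thesis by (simp add: x_def algebra_simps)
    qed
    with Suc show ?case by simp
  qed
  also have "\<dots> \<le> 2 / k" using assms by simp
  finally show ?thesis .
qed

text \<open>The quotient is the infinite product of \<open>(1 + 1/w)\<^sup>a / (1 + a/w)\<close> over \<open>w = \<i>k, \<i>k + 1, \<dots>\<close> with \<open>a = \<i>p\<close>,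
  whose factors are \<open>1 + O(1/\<bar>w\<bar>\<^sup>2)\<close>.\<close>

lemma Gamma_quotient_asymptotics:
  fixes P :: real
  assumes P: "P \<ge> 0"
  obtains C where "C \<ge> 0"
    "\<And>p k. 0 \<le> p \<Longrightarrow> p \<le> P \<Longrightarrow> k \<ge> 1 \<Longrightarrow>
      cmod (Gamma (\<i> * complex_of_real (p + k)) / Gamma (\<i> * complex_of_real k)
        * exp (- (\<i> * complex_of_real p * Ln (\<i> * complex_of_real k))) - 1) \<le> C / k"
proof
  \<comment> \<open>The first summand bounds the remainder of exp (a l) beyond first order, where |a
    l| \<le> 2 P and l is the increment of Ln; the second bounds a times the error of l against 1 /
    w.\<close>
  define C1 where "C1 = 4 * P\<^sup>2 * exp (2 * P) + P"
  have C1: "C1 \<ge> 0" using P by (simp add: C1_def)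
  \<comment> \<open>The deviations |q j - 1| sum to S \<le> 4 C1 / k, and exp S - 1 \<le> S exp S
    produces this constant.\<close>
  show "4 * C1 * exp (4 * C1) \<ge> 0" using C1 by simp
  fix p k :: real assume p: "0 \<le> p" "p \<le> P" and k: "k \<ge> 1"
  define a where "a = \<i> * complex_of_real p"
  define z where "z = \<i> * complex_of_real k"
  define w where "w j = z + of_nat j" for j :: nat
  define q where "q j = exp (a * (Ln (w (Suc j)) - Ln (w j))) * (w j / (w j + a))" for j
  have wRI: "Re (w j) = real j" "Im (w j) = k" for j by (auto simp: w_def z_def)
  have w0: "w j \<noteq> 0" and wa0: "w j + a \<noteq> 0" for j using wRI[of j] p k by (auto simp: complex_eq_iff a_def)
  have w1: "cmod (w j) \<ge> 1" for j using abs_Im_le_cmod[of "w j"] wRI[of j] k by linarith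
  have aP: "cmod a \<le> P" using p by (simp add: a_def norm_mult)
  have q_bound: "cmod (q j - 1) \<le> C1 / (cmod (w j))\<^sup>2" for j
  proof -
    let ?w = "w j"
    define l where "l = Ln (w (Suc j)) - Ln ?w"
    have l1: "cmod (l - 1 / ?w) \<le> 1 / (cmod ?w)\<^sup>2"
      using Ln_add_one_bound[of ?w] wRI[of j] k by (simp add: l_def w_def add_ac)
    have "cmod l \<le> cmod (l - 1 / ?w) + cmod (1 / ?w)" using norm_triangle_ineq[of "l - 1 / ?w" "1 / ?w"] by simp
    also have "\<dots> \<le> 1 / (cmod ?w)\<^sup>2 + 1 / cmod ?w" using l1 by (simp add: norm_divide)
    also have "1 / (cmod ?w)\<^sup>2 \<le> 1 / cmod ?w"
      using w1[of j] by (simp add: power2_eq_square divide_simps)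
    finally have l2: "cmod l \<le> 2 / cmod ?w" by simp
    have al: "cmod (a * l) \<le> 2 * P / cmod ?w"
      using mult_mono[OF aP l2] P by (simp add: norm_mult mult.commute)
    also have "\<dots> \<le> 2 * P" using w1[of j] P mult_left_mono[OF w1[of j] P] by (simp add: divide_simps)
    finally have al': "cmod (a * l) \<le> 2 * P" .
    have "cmod (exp (a * l) - (\<Sum>i\<le>1. (a * l) ^ i / (fact i))) \<le> exp \<bar>Re (a * l)\<bar> * (cmod (a * l)) ^ (Suc 1) / (fact 1)"
      by (rule Taylor_exp)
    also have "\<dots> \<le> exp (2 * P) * (2 * P / cmod ?w) ^ 2"
      using al al' abs_Re_le_cmod[of "a * l"] by (auto intro!: mult_mono power_mono simp: power2_eq_square[symmetric])
    finally have e1: "cmod (exp (a * l) - 1 - a * l) \<le> 4 * P\<^sup>2 * exp (2 * P) / (cmod ?w)\<^sup>2"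
      by (simp add: power_divide power_mult_distrib algebra_simps)
    have e2: "cmod (a * (l - 1 / ?w)) \<le> P * (1 / (cmod ?w)\<^sup>2)"
      unfolding norm_mult using l1 aP P by (intro mult_mono) auto
    have "cmod (exp (a * l) - 1 - a / ?w) \<le> cmod (exp (a * l) - 1 - a * l) + cmod (a * (l - 1 / ?w))"
      using norm_triangle_ineq[of "exp (a * l) - 1 - a * l" "a * (l - 1 / ?w)"] by (simp add: algebra_simps)
    also have "\<dots> \<le> C1 / (cmod ?w)\<^sup>2" using e1 e2 by (simp add: C1_def add_divide_distrib)
    finally have e: "cmod (exp (a * l) - 1 - a / ?w) \<le> C1 / (cmod ?w)\<^sup>2" .
    \<comment> \<open>Adding a = \<i>p with p \<ge> 0 raises a positive imaginary part, so the
      modulus does not decrease.\<close>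
    have wle: "cmod (?w / (?w + a)) \<le> 1"
    proof -
      have "cmod ?w \<le> cmod (?w + a)"
        using wRI[of j] p k unfolding cmod_def a_def by (intro real_sqrt_le_mono add_mono power_mono) auto
      then show ?thesis using wa0[of j] by (simp add: norm_divide)
    qed
    have "1 + a / ?w = (?w + a) / ?w" using w0[of j] by (simp add: add_divide_distrib)
    then have "(1 + a / ?w) * (?w / (?w + a)) = 1" using w0[of j] wa0[of j] by simp
    then have "q j - 1 = (exp (a * l) - 1 - a / ?w) * (?w / (?w + a))"
      unfolding q_def l_def[symmetric] by (simp add: algebra_simps)
    then have "cmod (q j - 1) \<le> cmod (exp (a * l) - 1 - a / ?w) * 1"
      using mult_left_mono[OF wle] by (metis norm_ge_zero norm_mult)
    with e show ?thesis by simp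
  qed
  \<comment> \<open>|w j|^2 = k^2 + j^2 is at least (k + j)^2 / 2, a form whose reciprocals can be
    summed by telescoping.\<close>
  have q_bound': "cmod (q j - 1) \<le> 2 * C1 * (1 / (k + real j)\<^sup>2)" for j
  proof -
    have "(k + real j)\<^sup>2 \<le> 2 * (cmod (w j))\<^sup>2"
      unfolding cmod_power2 wRI using sum_squares_bound[of k "real j"] by (simp add: power2_sum)
    then have "1 / (cmod (w j))\<^sup>2 \<le> 2 * (1 / (k + real j)\<^sup>2)"
      using k w0[of j] by (simp add: divide_simps add_nonneg_eq_0_iff)
    then have "C1 * (1 / (cmod (w j))\<^sup>2) \<le> C1 * (2 * (1 / (k + real j)\<^sup>2))"
      by (rule mult_left_mono) (rule C1)
    with q_bound[of j] show ?thesis by (simp add: mult_ac)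
  qed
  \<comment> \<open>The exponents telescope, and the fractions build the Pochhammer symbols of
    Euler's limit for Gamma.\<close>
  have prod_eq: "(\<Prod>j\<le>n. q j) = exp (a * (Ln (w (Suc n)) - Ln z)) * (pochhammer z (Suc n) / pochhammer (z + a) (Suc n))" for n
  proof (induction n)
    case 0
    then show ?case by (simp add: q_def w_def)
  next
    case (Suc n)
    have "q (Suc n) = exp (a * (Ln (w (Suc (Suc n))) - Ln (w (Suc n)))) * ((z + of_nat (Suc n)) / (z + a + of_nat (Suc n)))"
      unfolding q_def w_def by (simp add: add_ac)
    moreover have "exp (a * (Ln (w (Suc n)) - Ln z)) * exp (a * (Ln (w (Suc (Suc n))) - Ln (w (Suc n)))) = exp (a * (Ln (w (Suc (Suc n))) - Ln z))"
      by (simp add: exp_add[symmetric] algebra_simps)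
    ultimately show ?case using Suc
      by (simp only: prod.atMost_Suc pochhammer_Suc[of _ "Suc n"] times_divide_times_eq[symmetric] mult_ac)
         (simp add: mult_ac)
  qed
  have z_nonpos: "z \<notin> \<int>\<^sub>\<le>\<^sub>0" "z + a \<notin> \<int>\<^sub>\<le>\<^sub>0"
    using k p by (auto simp: nonpos_Ints_def z_def a_def complex_eq_iff)
  have Gz: "Gamma z \<noteq> 0" using z_nonpos by (simp add: Gamma_eq_zero_iff)
  have poch: "pochhammer z (Suc n) \<noteq> 0" for n
    using z_nonpos pochhammer_eq_0_imp_nonpos_Int by blast
  have prod_eq': "(\<Prod>j\<le>n. q j) = Gamma_series (z + a) n / Gamma_series z n * exp (a * (Ln (w (Suc n)) - of_real (ln (real n)))) * exp (- (a * Ln z))" for n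
  proof -
    have "Gamma_series (z + a) n / Gamma_series z n = exp (a * of_real (ln (real n))) * (pochhammer z (Suc n) / pochhammer (z + a) (Suc n))"
      using poch[of n] by (simp add: Gamma_series_def ring_distribs exp_add divide_simps)
    moreover have "exp (a * of_real (ln (real n))) * exp (a * (Ln (w (Suc n)) - of_real (ln (real n)))) * exp (- (a * Ln z)) = exp (a * (Ln (w (Suc n)) - Ln z))"
      by (simp add: exp_add[symmetric] algebra_simps)
    ultimately show ?thesis unfolding prod_eq by (simp add: mult_ac)
  qed
  \<comment> \<open>Telescoping leaves a power of \<open>w (Suc n)\<close>, Euler's limit a power of
    n; the correction between them tends to 1.\<close>
  have Lnlim: "(\<lambda>n. Ln (w (Suc n)) - of_real (ln (real n))) \<longlonglongrightarrow> 0"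
  proof -
    have "(\<lambda>n. (z + 1) * of_real (1 / real n) + 1) \<longlonglongrightarrow> (z + 1) * of_real 0 + 1"
      by (intro tendsto_intros lim_1_over_n)
    then have "(\<lambda>n. Ln ((z + 1) * of_real (1 / real n) + 1)) \<longlonglongrightarrow> Ln 1"
      by (intro tendsto_intros) (auto simp: complex_nonpos_Reals_iff)
    moreover have "\<forall>\<^sub>F n in sequentially. Ln ((z + 1) * of_real (1 / real n) + 1) = Ln (w (Suc n)) - of_real (ln (real n))"
      using eventually_gt_at_top[of 0]
    proof eventually_elim
      case (elim n)
      have "(z + 1) * of_real (1 / real n) + 1 = w (Suc n) / of_real (real n)"
        using elim by (simp add: w_def field_simps)
      then show ?case using elim w0 Ln_divide_of_real[of "real n" "w (Suc n)"] by simp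
    qed
    ultimately show ?thesis by (simp add: tendsto_cong)
  qed
  have "(\<lambda>n. \<Prod>j\<le>n. q j) \<longlonglongrightarrow> Gamma (z + a) / Gamma z * exp (a * 0) * exp (- (a * Ln z))"
    unfolding prod_eq' by (intro tendsto_intros Lnlim Gz)
  then have "(\<lambda>n. cmod ((\<Prod>j\<le>n. q j) - 1)) \<longlonglongrightarrow> cmod (Gamma (z + a) / Gamma z * exp (- (a * Ln z)) - 1)"
    by (intro tendsto_intros) simp
  moreover have "cmod ((\<Prod>j\<le>n. q j) - 1) \<le> 4 * C1 * exp (4 * C1) / k" for n
  proof -
    define S where "S = (\<Sum>j\<le>n. cmod (q j - 1))"
    have S0: "0 \<le> S" unfolding S_def by (intro sum_nonneg) auto
    have "S \<le> (\<Sum>j\<le>n. 2 * C1 * (1 / (k + real j)\<^sup>2))"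
      unfolding S_def by (intro sum_mono q_bound')
    also have "\<dots> = 2 * C1 * (\<Sum>j\<le>n. 1 / (k + real j)\<^sup>2)" by (simp only: sum_distrib_left)
    also have "\<dots> \<le> 2 * C1 * (2 / k)" using C1 by (intro mult_left_mono sum_inverse_squares_bound k) auto
    finally have S: "S \<le> 4 * C1 / k" by simp
    also have "\<dots> \<le> 4 * C1" using k C1 mult_left_mono[OF k C1] by (simp add: divide_simps)
    finally have S': "S \<le> 4 * C1" .
    have "cmod ((\<Prod>j\<le>n. q j) - 1) \<le> (\<Prod>j\<le>n. 1 + cmod (q j - 1)) - 1"
      using norm_prod_minus1_le_prod_minus1[of "\<lambda>j. q j - 1" "{..n}"] by simp
    also have "(\<Prod>j\<le>n. 1 + cmod (q j - 1)) \<le> exp S"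
      unfolding S_def exp_sum[OF finite_atMost] by (intro prod_mono) auto
    also have "exp S - 1 \<le> S * exp S"
    proof -
      have "1 - S \<le> exp (- S)" using exp_ge_add_one_self[of "- S"] by simp
      then have "(1 - S) * exp S \<le> exp (- S) * exp S" by (intro mult_right_mono) auto
      then show ?thesis by (simp add: algebra_simps flip: exp_add)
    qed
    also have "S * exp S \<le> (4 * C1 / k) * exp (4 * C1)"
      using S S' S0 by (intro mult_mono) auto
    finally show ?thesis by simp
  qed
  ultimately have "cmod (Gamma (z + a) / Gamma z * exp (- (a * Ln z)) - 1) \<le> 4 * C1 * exp (4 * C1) / k"
    by (intro LIMSEQ_le_const2) auto
  then show "cmod (Gamma (\<i> * complex_of_real (p + k)) / Gamma (\<i> * complex_of_real k)
        * exp (- (\<i> * complex_of_real p * Ln (\<i> * complex_of_real k))) - 1) \<le> 4 * C1 * exp (4 * C1) / k"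
    unfolding a_def z_def by (simp add: ring_distribs add_ac)
qed

section \<open>The Bogoliubov kernel of the mirror trajectory\<close>

text \<open>The two exponents of this Beta function add up to \<i>k. The denominator is written with
  the entire function \<open>rGamma\<close>, whose zero at k = 0 governs small k.\<close>

definition beta_kernel :: "real \<Rightarrow> real \<Rightarrow> complex" where
  "beta_kernel p k = Gamma (\<i> * complex_of_real (p + k)) * Gamma (- (\<i> * complex_of_real p)) * rGamma (\<i> * complex_of_real k)"

lemma not_nonpos_Int_if_Im: "Im z \<noteq> 0 \<Longrightarrow> z \<notin> \<int>\<^sub>\<le>\<^sub>0"
  by (auto simp: nonpos_Ints_def)

lemma continuous_on_Gamma_compose [continuous_intros]:
  "continuous_on A f \<Longrightarrow> (\<And>x. x \<in> A \<Longrightarrow> f x \<notin> \<int>\<^sub>\<le>\<^sub>0) \<Longrightarrow> continuous_on A (\<lambda>x. Gamma (f x))"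
  by (rule continuous_on_compose2[OF continuous_on_Gamma[of "- \<int>\<^sub>\<le>\<^sub>0"]]) auto

lemma continuous_on_rGamma_compose [continuous_intros]:
  "continuous_on A f \<Longrightarrow> continuous_on A (\<lambda>x. rGamma (f x))"
  by (rule continuous_on_compose2[OF continuous_on_rGamma[of UNIV]]) auto

text \<open>The limit e -> 0 of a damped identity. In y the integrable packet itself is the
  majorant. In p the damped kernel is bounded uniformly in e, because the support in [c, d] keeps
  -\<i>p away from the pole of Gamma at 0.\<close>

lemma checkft_eq_beta_kernel:
  fixes g :: "real \<Rightarrow> complex"
  assumes g: "integrable lborel g" and supp: "\<And>p. g p \<noteq> 0 \<Longrightarrow> p \<in> {c..d}" and c: "c > 0"
    and f: "integrable lborel (shift y0 (invFT g))" and k: "k > 0"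
  shows "checkft (shift y0 (invFT g)) k = complex_of_real (1 / (2 * pi)) * (LINT p|lborel. g p * cis (- (p * y0)) * beta_kernel p k)"
proof -
  define f where "f = shift y0 (invFT g)"
  have fint: "integrable lborel f" using f by (simp add: f_def)
  note [measurable] = borel_measurable_integrable[OF fint] borel_measurable_integrable[OF g]
  define l where "l y = ln (1 + exp y)" for y :: real
  have [measurable]: "l \<in> borel_measurable borel" unfolding l_def[abs_def] by measurable
  have xl: "xmap y = y - l y" for y
  proof -
    have pos: "1 + exp (- y) > 0" by (simp add: add_pos_pos)
    have "ln (1 + exp y) = ln (exp y * (1 + exp (- y)))" by (simp add: ring_distribs exp_minus add.commute)
    also have "\<dots> = y + ln (1 + exp (- y))" using pos by (simp add: ln_mult)
    finally show ?thesis by (simp add: xmap_def l_def)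
  qed
  have [measurable]: "xmap \<in> borel_measurable borel" unfolding xmap_def[abs_def] by measurable
  have neg: "xmap y - l y \<le> 0" for y
  proof -
    have "0 \<le> l y" "0 \<le> ln (1 + exp (- y))" unfolding l_def by (intro ln_ge_zero; simp)+
    then show ?thesis unfolding xmap_def by linarith
  qed
  define e where "e n = 1 / real (Suc n)" for n
  have e0: "e n > 0" "e n \<le> 1" for n by (auto simp: e_def)
  have elim: "e \<longlonglongrightarrow> 0" unfolding e_def by (rule LIMSEQ_Suc[OF lim_1_over_n])
  \<comment> \<open>With u = exp (xmap y) one has exp (xmap y - l y) = u (1 - u). Its power
    \<open>e n\<close> adds \<open>e n\<close> to both Beta exponents.\<close>
  define A where "A n y = cis (k * xmap y) * complex_of_real (exp (e n * (xmap y - l y)))" for n y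
  have [measurable]: "A n \<in> borel_measurable borel" for n unfolding A_def by measurable
  have A1: "cmod (A n y) \<le> 1" for n y
    using e0[of n] neg[of y] by (simp add: A_def norm_mult mult_nonneg_nonpos)
  have Aint: "integrable lborel (A n)" for n
  \<comment> \<open>In modulus \<open>A n\<close> is the Beta integrand with both exponents equal to
    \<open>e n\<close>.\<close>
  proof (rule Bochner_Integration.integrable_bound)
    show "integrable lborel (\<lambda>y. exp (complex_of_real (e n) * complex_of_real y - (complex_of_real (e n) + complex_of_real (e n)) * complex_of_real (ln (1 + exp y))))"
      using e0[of n] by (intro Beta_exp_integral) auto
    show "AE y in lborel. norm (A n y) \<le> norm (exp (complex_of_real (e n) * complex_of_real y - (complex_of_real (e n) + complex_of_real (e n)) * complex_of_real (ln (1 + exp y))))"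
      by (auto simp: A_def norm_mult xl l_def algebra_simps)
  qed simp
  define Mn where "Mn n p = Gamma (complex_of_real (e n) + \<i> * complex_of_real (p + k)) * Gamma (complex_of_real (e n) - \<i> * complex_of_real p)
      * rGamma (2 * complex_of_real (e n) + \<i> * complex_of_real k)" for n p
  have inner: "(LINT y|lborel. A n y * cis (y * p)) = Mn n p" for n p
  proof -
    have "A n y * cis (y * p) = exp ((complex_of_real (e n) + \<i> * complex_of_real (p + k)) * complex_of_real y
       - ((complex_of_real (e n) + \<i> * complex_of_real (p + k)) + (complex_of_real (e n) - \<i> * complex_of_real p)) * complex_of_real (ln (1 + exp y)))" for y
      unfolding A_def l_def[symmetric] cis_conv_exp exp_of_real[symmetric] exp_add[symmetric] xl
      by (rule arg_cong[of _ _ exp]) (simp add: algebra_simps)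
    moreover have "(complex_of_real (e n) + \<i> * complex_of_real (p + k)) + (complex_of_real (e n) - \<i> * complex_of_real p) = 2 * complex_of_real (e n) + \<i> * complex_of_real k"
      by (simp add: algebra_simps)
    ultimately show ?thesis
      using Beta_exp_integral(2)[of "complex_of_real (e n) + \<i> * complex_of_real (p + k)" "complex_of_real (e n) - \<i> * complex_of_real p"] e0[of n]
      by (simp add: Mn_def rGamma_inverse_Gamma divide_inverse)
  qed
  define B where "B p = g p * cis (- (p * y0))" for p
  have [measurable]: "B \<in> borel_measurable borel" unfolding B_def[abs_def] by measurable
  have Bint: "integrable lborel B"
    by (rule Bochner_Integration.integrable_bound[OF g]) (auto simp: B_def norm_mult)
  have fB: "f y = complex_of_real (1 / sqrt (2 * pi)) * (LINT p|lborel. B p * cis (y * p))" for y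
  proof -
    have "g p * cis (p * (y - y0)) = B p * cis (y * p)" for p
      unfolding B_def mult.assoc cis_mult by (simp add: algebra_simps)
    then show ?thesis by (simp add: f_def shift_def invFT_def)
  qed
  have reg: "(LINT y|lborel. f y * A n y) = complex_of_real (1 / sqrt (2 * pi)) * (LINT p|lborel. B p * Mn n p)" for n
  proof -
    have "(LINT y|lborel. f y * A n y) = (LINT y|lborel. complex_of_real (1 / sqrt (2 * pi)) * (A n y * (LINT p|lborel. B p * cis (y * p))))"
      unfolding fB by (simp add: mult_ac)
    also have "\<dots> = complex_of_real (1 / sqrt (2 * pi)) * (LINT y|lborel. A n y * (LINT p|lborel. B p * cis (y * p)))"
      by (rule integral_mult_right_zero)
    also have "(LINT y|lborel. A n y * (LINT p|lborel. B p * cis (y * p))) = (LINT p|lborel. B p * Mn n p)"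
      unfolding inner[symmetric] by (rule integral_kernel_swap[OF Aint Bint]) auto
    finally show ?thesis .
  qed
  have lim1: "(\<lambda>n. LINT y|lborel. f y * A n y) \<longlonglongrightarrow> (LINT y|lborel. f y * cis (k * xmap y))"
  proof (rule integral_dominated_convergence[where w="\<lambda>y. cmod (f y)"])
    show "AE y in lborel. (\<lambda>n. f y * A n y) \<longlonglongrightarrow> f y * cis (k * xmap y)"
    proof (rule AE_I2)
      fix y
      have "(\<lambda>n. f y * A n y) \<longlonglongrightarrow> f y * (cis (k * xmap y) * complex_of_real (exp (0 * (xmap y - l y))))"
        unfolding A_def by (intro tendsto_intros elim)
      then show "(\<lambda>n. f y * A n y) \<longlonglongrightarrow> f y * cis (k * xmap y)" by simp
    qed
    show "AE y in lborel. norm (f y * A n y) \<le> cmod (f y)" for n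
      using A1 by (auto simp: norm_mult intro!: mult_right_le_one_le)
  qed (use fint in auto)
  \<comment> \<open>The damped kernel as a function of (e, p): its continuity on a compact rectangle
    that includes e = 0 gives one bound for all n.\<close>
  define Mc where "Mc x = Gamma (complex_of_real (fst x) + \<i> * complex_of_real (snd x + k)) * Gamma (complex_of_real (fst x) - \<i> * complex_of_real (snd x))
      * rGamma (2 * complex_of_real (fst x) + \<i> * complex_of_real k)" for x
  have Mc_cont: "continuous_on ({0..1} \<times> {c..d}) Mc"
    unfolding Mc_def using c k by (intro continuous_intros) (auto intro!: not_nonpos_Int_if_Im)
  have "bounded (Mc ` ({0..1} \<times> {c..d}))"
    by (intro compact_imp_bounded compact_continuous_image Mc_cont compact_Times) auto
  then obtain C where C: "\<And>x. x \<in> {0..1} \<times> {c..d} \<Longrightarrow> cmod (Mc x) \<le> C"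
    unfolding bounded_iff by blast
  have MnMc: "Mn n p = Mc (e n, p)" for n p by (simp add: Mn_def Mc_def)
  have M_cont: "continuous_on {c..d} (Mn n)" for n
    unfolding Mn_def using c k by (intro continuous_intros) (auto intro!: not_nonpos_Int_if_Im)
  \<comment> \<open>m is controlled only on [c, d]; cutting it off there changes nothing, since
    \<open>B\<close> vanishes outside.\<close>
  have BM_meas: "(\<lambda>p. B p * m p) \<in> borel_measurable borel" if "continuous_on {c..d} m" for m
  proof -
    have [measurable]: "(\<lambda>p. indicator {c..d} p *\<^sub>R m p) \<in> borel_measurable borel"
      by (rule borel_measurable_continuous_on_indicator[OF _ that]) simp
    have "(\<lambda>p. B p * (indicator {c..d} p *\<^sub>R m p)) \<in> borel_measurable borel" by measurable
    also have "(\<lambda>p. B p * (indicator {c..d} p *\<^sub>R m p)) = (\<lambda>p. B p * m p)"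
      using supp by (auto simp: B_def indicator_def fun_eq_iff)
    finally show ?thesis .
  qed
  have [measurable]: "(\<lambda>p. B p * Mn n p) \<in> borel_measurable borel" for n
    by (rule BM_meas[OF M_cont])
  have bk_cont: "continuous_on {c..d} (\<lambda>p. beta_kernel p k)"
    unfolding beta_kernel_def using c k by (intro continuous_intros) (auto intro!: not_nonpos_Int_if_Im)
  have [measurable]: "(\<lambda>p. B p * beta_kernel p k) \<in> borel_measurable borel"
    by (rule BM_meas[OF bk_cont])
  have lim2: "(\<lambda>n. LINT p|lborel. B p * Mn n p) \<longlonglongrightarrow> (LINT p|lborel. B p * beta_kernel p k)"
  proof (rule integral_dominated_convergence[where w="\<lambda>p. cmod (B p) * C"])
    show "AE p in lborel. (\<lambda>n. B p * Mn n p) \<longlonglongrightarrow> B p * beta_kernel p k"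
    proof (rule AE_I2)
      fix p
      show "(\<lambda>n. B p * Mn n p) \<longlonglongrightarrow> B p * beta_kernel p k"
      proof (cases "p \<in> {c..d}")
        case True
        have "(\<lambda>n. Mn n p) \<longlonglongrightarrow> Gamma (complex_of_real 0 + \<i> * complex_of_real (p + k)) * Gamma (complex_of_real 0 - \<i> * complex_of_real p)
            * rGamma (2 * complex_of_real 0 + \<i> * complex_of_real k)"
          unfolding Mn_def using True c k
          by (intro tendsto_intros elim isCont_tendsto_compose[OF isCont_rGamma[OF continuous_ident]])
             (auto intro!: not_nonpos_Int_if_Im)
        then show ?thesis by (intro tendsto_intros) (simp add: beta_kernel_def)
      next
        case False
        then have "g p = 0" using supp by blast
        then show ?thesis by (simp add: B_def)
      qed
    qed
    show "AE p in lborel. norm (B p * Mn n p) \<le> cmod (B p) * C" for n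
    proof (rule AE_I2)
      fix p
      show "norm (B p * Mn n p) \<le> cmod (B p) * C"
      proof (cases "p \<in> {c..d}")
        case True
        then show ?thesis unfolding norm_mult MnMc using e0[of n]
          by (intro mult_left_mono C) auto
      next
        case False
        then have "g p = 0" using supp by blast
        then show ?thesis by (simp add: B_def)
      qed
    qed
  qed (use Bint in auto)
  have "(\<lambda>n. LINT y|lborel. f y * A n y) \<longlonglongrightarrow> complex_of_real (1 / sqrt (2 * pi)) * (LINT p|lborel. B p * beta_kernel p k)"
    unfolding reg by (intro tendsto_intros lim2)
  with lim1 have "(LINT y|lborel. f y * cis (k * xmap y)) = complex_of_real (1 / sqrt (2 * pi)) * (LINT p|lborel. B p * beta_kernel p k)"
    by (rule LIMSEQ_unique)
  moreover have "complex_of_real (1 / sqrt (2 * pi)) * complex_of_real (1 / sqrt (2 * pi)) = complex_of_real (1 / (2 * pi))"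
    unfolding of_real_mult[symmetric] by simp
  ultimately show ?thesis
    unfolding checkft_def f_def[symmetric] B_def by (simp add: mult.assoc[symmetric] del: of_real_mult of_real_divide)
qed

text \<open>1 / Gamma(\<i>k) = \<i>k / Gamma(\<i>k + 1) has a simple zero at k = 0; the cofactor is
  continuous up to k = 0 and bounded by compactness.\<close>

lemma beta_kernel_small:
  assumes c: "0 < c"
  obtains C where "C \<ge> 0" "\<And>p k. p \<in> {c..d} \<Longrightarrow> 0 < k \<Longrightarrow> k \<le> 1 \<Longrightarrow> cmod (beta_kernel p k) \<le> C * k"
proof -
  define H where "H x = Gamma (\<i> * complex_of_real (fst x + snd x)) * Gamma (- (\<i> * complex_of_real (fst x))) * rGamma (\<i> * complex_of_real (snd x) + 1)" for x
  have "continuous_on ({c..d} \<times> {0..1}) H"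
    unfolding H_def using c by (intro continuous_intros) (auto intro!: not_nonpos_Int_if_Im)
  then have "bounded (H ` ({c..d} \<times> {0..1}))"
    by (intro compact_imp_bounded compact_continuous_image compact_Times) auto
  then obtain C where C: "C > 0" "\<And>x. x \<in> {c..d} \<times> {0..1} \<Longrightarrow> cmod (H x) \<le> C"
    unfolding bounded_pos by blast
  show thesis
  proof (rule that)
    show "C \<ge> 0" using C by simp
    fix p k :: real assume p: "p \<in> {c..d}" and k: "0 < k" "k \<le> 1"
    have "beta_kernel p k = \<i> * complex_of_real k * H (p, k)"
      unfolding beta_kernel_def H_def by (simp flip: rGamma_plus1[of "\<i> * complex_of_real k"])
    moreover have "cmod (H (p, k)) * k \<le> C * k" using p k by (intro mult_right_mono C) auto
    ultimately show "cmod (beta_kernel p k) \<le> C * k" using k by (simp add: norm_mult mult_ac)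
  qed
qed

text \<open>The coefficient of k^(\<i>p) in the kernel for large k. The exponential is the modulus
  of (\<i>k)^(\<i>p), since Ln \<i> = \<i> pi / 2.\<close>

definition beta_amplitude :: "real \<Rightarrow> complex" where
  "beta_amplitude p = Gamma (- (\<i> * complex_of_real p)) * complex_of_real (exp (- (pi * p / 2)))"

lemma continuous_on_beta_amplitude: "continuous_on {0<..} beta_amplitude"
  unfolding beta_amplitude_def[abs_def] by (intro continuous_intros) (auto intro!: not_nonpos_Int_if_Im)

text \<open>Gamma(-\<i>p) and Gamma(\<i>p) are conjugate, so reflection gives pi / (p sinh (pi p))
  for the squared modulus. The factor exp (-pi p) turns this into the Planck form: here the
  temperature appears.\<close>

lemma cmod_beta_amplitude:
  assumes "p > 0"
  shows "(cmod (beta_amplitude p))\<^sup>2 = 2 * pi / (p * (exp (2 * pi * p) - 1))"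
proof -
  let ?z = "\<i> * complex_of_real p"
  have "complex_of_real ((cmod (Gamma (- ?z)))\<^sup>2) = Gamma (- ?z) * Gamma (cnj (- ?z))"
    unfolding complex_norm_square cnj_Gamma ..
  also have "\<dots> = Gamma ?z * Gamma (- ?z)" by (simp add: mult.commute)
  also have "\<dots> = - complex_of_real pi / (?z * sin (complex_of_real pi * ?z))"
    by (rule Gamma_reflection_complex')
  also have "sin (complex_of_real pi * ?z) = \<i> * complex_of_real (sinh (pi * p))"
  proof -
    have 1: "complex_of_real pi * ?z = \<i> * complex_of_real (pi * p)" by (simp add: mult_ac)
    have 2: "sin (\<i> * complex_of_real x) = \<i> * sinh (complex_of_real x)" for x
      unfolding sinh_conv_sin by (simp flip: mult.assoc)
    have 3: "sinh (complex_of_real x) = complex_of_real (sinh x)" for x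
      unfolding sinh_field_def by (simp add: exp_of_real[symmetric])
    show ?thesis unfolding 1 2 3 ..
  qed
  also have "- complex_of_real pi / (?z * (\<i> * complex_of_real (sinh (pi * p)))) = complex_of_real (pi / (p * sinh (pi * p)))"
    by (simp add: field_simps)
  finally have "(cmod (Gamma (- ?z)))\<^sup>2 = pi / (p * sinh (pi * p))"
    unfolding of_real_eq_iff .
  then have "(cmod (beta_amplitude p))\<^sup>2 = pi / (p * sinh (pi * p)) * (exp (- (pi * p / 2)))\<^sup>2"
    by (simp add: beta_amplitude_def norm_mult power_mult_distrib)
  also have "(exp (- (pi * p / 2)))\<^sup>2 = inverse (exp (pi * p))"
    by (simp add: power2_eq_square exp_add[symmetric] exp_minus[symmetric])
  also have "sinh (pi * p) = (exp (2 * pi * p) - 1) / (2 * exp (pi * p))"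
    by (simp add: sinh_field_def exp_minus field_simps exp_add[symmetric])
  finally show ?thesis by (simp add: field_simps)
qed

text \<open>The kernel is \<open>beta_amplitude p\<close> times k^(\<i>p) times a normalised Gamma
  quotient, which is 1 + O(1 / k) uniformly in p; the amplitude is bounded on the compact
  interval.\<close>

lemma beta_kernel_large:
  assumes c: "0 < c"
  obtains C where "C \<ge> 0" "\<And>p k. p \<in> {c..d} \<Longrightarrow> k \<ge> 1 \<Longrightarrow>
    cmod (beta_kernel p k - beta_amplitude p * cis (p * ln k)) \<le> C / k"
proof -
  \<comment> \<open>The maximum with 0 supplies the nonnegative upper bound that the quotient
    estimate asks for.\<close>
  obtain C where C: "C \<ge> 0" 
    "\<And>p k. 0 \<le> p \<Longrightarrow> p \<le> max d 0 \<Longrightarrow> k \<ge> 1 \<Longrightarrow>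
      cmod (Gamma (\<i> * complex_of_real (p + k)) / Gamma (\<i> * complex_of_real k)
        * exp (- (\<i> * complex_of_real p * Ln (\<i> * complex_of_real k))) - 1) \<le> C / k"
    using Gamma_quotient_asymptotics[of "max d 0"] by auto
  have "bounded (beta_amplitude ` {c..d})"
    using c by (intro compact_imp_bounded compact_continuous_image continuous_on_subset[OF continuous_on_beta_amplitude]) auto
  then obtain A where A: "A > 0" "\<And>p. p \<in> {c..d} \<Longrightarrow> cmod (beta_amplitude p) \<le> A"
    unfolding bounded_pos by blast
  show thesis
  proof (rule that)
    show "A * C \<ge> 0" using A C by simp
    fix p k :: real assume p: "p \<in> {c..d}" and k: "k \<ge> 1"
    define R where "R = Gamma (\<i> * complex_of_real (p + k)) / Gamma (\<i> * complex_of_real k)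
        * exp (- (\<i> * complex_of_real p * Ln (\<i> * complex_of_real k)))"
    have Lnk: "Ln (\<i> * complex_of_real k) = complex_of_real (ln k) + \<i> * complex_of_real (pi / 2)"
      using k Ln_times_of_real[of k \<i>] by (simp add: mult.commute Ln_of_real)
    have "exp (\<i> * complex_of_real p * Ln (\<i> * complex_of_real k)) = cis (p * ln k) * complex_of_real (exp (- (pi * p / 2)))"
      unfolding Lnk cis_conv_exp exp_of_real[symmetric] exp_add[symmetric]
      by (rule arg_cong[of _ _ exp]) (simp add: algebra_simps)
    moreover have "R * exp (\<i> * complex_of_real p * Ln (\<i> * complex_of_real k)) = Gamma (\<i> * complex_of_real (p + k)) / Gamma (\<i> * complex_of_real k)"
      unfolding R_def by (simp add: mult.assoc flip: exp_add)
    ultimately have "beta_kernel p k = beta_amplitude p * cis (p * ln k) * R"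
      unfolding beta_kernel_def beta_amplitude_def rGamma_inverse_Gamma divide_inverse by (simp add: mult_ac)
    then have "beta_kernel p k - beta_amplitude p * cis (p * ln k) = beta_amplitude p * cis (p * ln k) * (R - 1)"
      by (simp add: right_diff_distrib)
    then have "cmod (beta_kernel p k - beta_amplitude p * cis (p * ln k)) = cmod (beta_amplitude p) * cmod (R - 1)"
      by (simp add: norm_mult)
    also have "\<dots> \<le> A * (C / k)"
      unfolding R_def using p k c A(1) by (intro mult_mono A(2) C(2)) auto
    finally show "cmod (beta_kernel p k - beta_amplitude p * cis (p * ln k)) \<le> A * C / k" by simp
  qed
qed

section \<open>Wave packets\<close>

text \<open>u may be singular at 0, as Gamma factors are. The product vanishes on the open set p <
  c, which together with p > 0 covers the line.\<close>

lemma continuous_on_mult_supported: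
  fixes g :: "real \<Rightarrow> real" and u :: "real \<Rightarrow> complex"
  assumes g: "continuous_on UNIV g" and supp: "\<And>p. g p \<noteq> 0 \<Longrightarrow> p \<in> {c..d}" and c: "0 < c"
    and u: "continuous_on {0<..} u"
  shows "continuous_on UNIV (\<lambda>p. u p * complex_of_real (g p))"
proof -
  have "continuous_on ({0<..} \<union> {..<c}) (\<lambda>p. u p * complex_of_real (g p))"
  proof (rule continuous_on_open_Un)
    show "continuous_on {0<..} (\<lambda>p. u p * complex_of_real (g p))"
      by (intro continuous_intros u continuous_on_subset[OF g]) auto
    have "continuous_on {..<c} (\<lambda>p. 0 :: complex)" by simp
    then show "continuous_on {..<c} (\<lambda>p. u p * complex_of_real (g p))"
      by (rule continuous_on_eq) (use supp in force)
  qed auto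
  also have "{0<..} \<union> {..<c} = UNIV" using c by auto
  finally show ?thesis .
qed

lemma supported_bounded_integrable:
  fixes G :: "real \<Rightarrow> complex"
  assumes cont: "continuous_on UNIV G" and supp: "\<And>p. G p \<noteq> 0 \<Longrightarrow> p \<in> {c..d}"
  shows "integrable lborel G" "integrable lborel (\<lambda>p. (cmod (G p))\<^sup>2)" "\<exists>B. \<forall>x. cmod (G x) \<le> B"
proof -
  have 1: "integrable lborel (\<lambda>x. indicator {c..d} x *\<^sub>R G x)"
    by (rule borel_integrable_compact) (auto intro: continuous_on_subset[OF cont])
  have "(\<lambda>x. indicator {c..d} x *\<^sub>R G x) = G"
    using supp by (auto simp: indicator_def fun_eq_iff)
  with 1 show "integrable lborel G" by simp
  have 2: "integrable lborel (\<lambda>x. indicator {c..d} x *\<^sub>R (cmod (G x))\<^sup>2)"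
    by (rule borel_integrable_compact) (auto intro!: continuous_intros continuous_on_subset[OF cont])
  have "(\<lambda>x. indicator {c..d} x *\<^sub>R (cmod (G x))\<^sup>2) = (\<lambda>x. (cmod (G x))\<^sup>2)"
    using supp by (auto simp: indicator_def fun_eq_iff)
  with 2 show "integrable lborel (\<lambda>p. (cmod (G p))\<^sup>2)" by simp
  have "bounded (G ` {c..d})"
    by (intro compact_imp_bounded compact_continuous_image continuous_on_subset[OF cont]) auto
  then obtain B where B: "B > 0" "\<And>x. x \<in> {c..d} \<Longrightarrow> cmod (G x) \<le> B" unfolding bounded_pos by blast
  then have "cmod (G x) \<le> B" for x using supp[of x] by (cases "G x = 0") auto
  then show "\<exists>B. \<forall>x. cmod (G x) \<le> B" by blast
qed

text \<open>The bound \<open>\<delta> \<le> po / 2\<close> confines all supports to {po / 2..3 * po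
  / 2}, a compact set away from p = 0 that is the same for every \<delta>. Kernel constants are
  therefore uniform in \<delta>.\<close>

locale packet =
  fixes po \<delta> :: real and D :: "real \<Rightarrow> real"
  assumes po: "po > 0" and \<delta>: "0 < \<delta>" "\<delta> \<le> po / 2" and D: "packet_conds po \<delta> D"
begin

abbreviation "g \<equiv> wave_ft po D"
abbreviation "Dp p \<equiv> D (p - po)"

lemma D_measurable [measurable]: "D \<in> borel_measurable borel"
  using D by (simp add: packet_conds_def)

lemma D_nonneg: "0 \<le> D p"
  using D by (simp add: packet_conds_def)

lemma Dp_supp: "Dp p \<noteq> 0 \<Longrightarrow> p \<in> {po - \<delta><..<po + \<delta>}"
proof -
  assume "Dp p \<noteq> 0"
  then have "p - po \<in> closure {p. D p \<noteq> 0}" using closure_subset[of "{p. D p \<noteq> 0}"] by auto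
  then have "p - po \<in> {-\<delta><..<\<delta>}" using D unfolding packet_conds_def by blast
  then show ?thesis by auto
qed

lemma Dp_supp': "Dp p \<noteq> 0 \<Longrightarrow> p \<in> {po / 2..3 * po / 2}"
  using Dp_supp[of p] \<delta> by auto

lemma g_eq: "g p = sqrt (2 * p) * Dp p"
  using Dp_supp'[of p] po by (cases "Dp p = 0") (auto simp: wave_ft_def)

lemma g_supp: "g p \<noteq> 0 \<Longrightarrow> p \<in> {po / 2..3 * po / 2}"
  using Dp_supp'[of p] by (auto simp: g_eq)

lemma g_continuous: "continuous_on UNIV g"
proof -
  obtain r E where E: "E 0 = g" "\<forall>k<r. \<forall>x. (E k has_real_derivative E (Suc k) x) (at x)" "continuous_on UNIV (E r)"
    using D unfolding packet_conds_def regularity_cond_def by blast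
  show ?thesis
  proof (cases "r = 0")
    case False
    then have "isCont g x" for x using E(1) E(2)[rule_format, of 0 x] by (auto intro: DERIV_isCont)
    then show ?thesis by (simp add: continuous_on_eq_continuous_at)
  qed (use E in simp)
qed

text \<open>On the support D is g / sqrt (2p), so it inherits the continuity of g. The factor u will
  be 1, the amplitude error, or the kernel with its phase.\<close>

lemma mult_Dp:
  assumes u: "continuous_on {0<..} u"
  shows "continuous_on UNIV (\<lambda>p. u p * complex_of_real (Dp p))"
    "integrable lborel (\<lambda>p. u p * complex_of_real (Dp p))"
    "integrable lborel (\<lambda>p. (cmod (u p * complex_of_real (Dp p)))\<^sup>2)"
    "\<exists>B. \<forall>p. cmod (u p * complex_of_real (Dp p)) \<le> B"
proof -
  have "continuous_on UNIV (\<lambda>p. u p / complex_of_real (sqrt (2 * p)) * complex_of_real (g p))"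
    by (rule continuous_on_mult_supported[OF g_continuous g_supp])
       (use po in \<open>auto intro!: continuous_intros u\<close>)
  also have "(\<lambda>p. u p / complex_of_real (sqrt (2 * p)) * complex_of_real (g p)) = (\<lambda>p. u p * complex_of_real (Dp p))"
  proof
    fix p show "u p / complex_of_real (sqrt (2 * p)) * complex_of_real (g p) = u p * complex_of_real (Dp p)"
      using Dp_supp'[of p] po by (cases "Dp p = 0") (auto simp: g_eq)
  qed
  finally show c: "continuous_on UNIV (\<lambda>p. u p * complex_of_real (Dp p))" .
  have s: "u p * complex_of_real (Dp p) \<noteq> 0 \<Longrightarrow> p \<in> {po / 2..3 * po / 2}" for p
    using Dp_supp'[of p] by auto
  show "integrable lborel (\<lambda>p. u p * complex_of_real (Dp p))"
    "integrable lborel (\<lambda>p. (cmod (u p * complex_of_real (Dp p)))\<^sup>2)"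
    "\<exists>B. \<forall>p. cmod (u p * complex_of_real (Dp p)) \<le> B"
    using supported_bounded_integrable[OF c s] by auto
qed

lemma Dp_square: "integrable lborel (\<lambda>p. (Dp p)\<^sup>2)" "(LINT p|lborel. (Dp p)\<^sup>2) = 1"
proof -
  show i: "integrable lborel (\<lambda>p. (Dp p)\<^sup>2)"
    using mult_Dp(3)[of "\<lambda>_. 1"] by (simp add: power2_abs)
  have "ennreal (LINT p|lborel. (Dp p)\<^sup>2) = (\<integral>\<^sup>+p. ennreal ((Dp p)\<^sup>2) \<partial>lborel)"
    by (rule nn_integral_eq_integral[symmetric, OF i]) simp
  also have "\<dots> = (\<integral>\<^sup>+p. ennreal ((D p)\<^sup>2) \<partial>lborel)"
    using nn_integral_real_affine[of "\<lambda>p. ennreal ((D p)\<^sup>2)" 1 "- po"] by simp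
  also have "\<dots> = 1" using D by (simp add: packet_conds_def)
  finally show "(LINT p|lborel. (Dp p)\<^sup>2) = 1" by (simp add: ennreal_eq_1)
qed

lemma Dp_integrable: "integrable lborel Dp"
proof -
  have "integrable lborel (\<lambda>p. complex_of_real (Dp p))" using mult_Dp(2)[of "\<lambda>_. 1"] by simp
  then show ?thesis by (rule Bochner_Integration.integrable_bound) auto
qed

text \<open>Cauchy-Schwarz on an interval of length 2\<delta>, in pointwise form: D \<le> l D^2 / 2
  + 1 / (2 l), where l = sqrt (2\<delta>) makes both parts integrate to l / 2.\<close>

lemma Dp_integral: "0 \<le> (LINT p|lborel. Dp p)" "(LINT p|lborel. Dp p) \<le> sqrt (2 * \<delta>)"
proof -
  show "0 \<le> (LINT p|lborel. Dp p)" using D_nonneg by (intro integral_nonneg_AE) auto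
  let ?I = "indicator {po - \<delta>..po + \<delta>} :: real \<Rightarrow> real"
  define l where "l = sqrt (2 * \<delta>)"
  have l: "l > 0" "l * l = 2 * \<delta>" using \<delta> by (auto simp: l_def)
  have le: "Dp p \<le> l / 2 * (Dp p)\<^sup>2 + 1 / (2 * l) * ?I p" for p
  proof (cases "Dp p = 0")
    case False
    then have "?I p = 1" using Dp_supp[of p] by auto
    moreover have "0 \<le> (l * Dp p - 1)\<^sup>2 / (2 * l)" using l by simp
    then have "Dp p \<le> l / 2 * (Dp p)\<^sup>2 + 1 / (2 * l)"
      using l(1) by (simp add: power2_diff power2_eq_square field_simps)
    ultimately show ?thesis by simp
  qed (use l in simp)
  have int: "integrable lborel (\<lambda>p. l / 2 * (Dp p)\<^sup>2 + 1 / (2 * l) * ?I p)"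
    using Dp_square(1) \<delta> by (intro Bochner_Integration.integrable_add integrable_mult_right integrable_real_indicator) auto
  have "(LINT p|lborel. Dp p) \<le> (LINT p|lborel. l / 2 * (Dp p)\<^sup>2 + 1 / (2 * l) * ?I p)"
    by (rule integral_mono[OF Dp_integrable int le])
  also have "\<dots> = l / 2 + 1 / (2 * l) * (2 * \<delta>)"
    using Dp_square \<delta> by (subst Bochner_Integration.integral_add) auto
  also have "\<dots> = l" using l by (simp add: field_simps)
  finally show "(LINT p|lborel. Dp p) \<le> sqrt (2 * \<delta>)" by (simp add: l_def)
qed

lemma g_integrable: "integrable lborel (\<lambda>p. complex_of_real (g p))"
  and g_cont: "continuous_on UNIV (\<lambda>p. complex_of_real (g p))"
  and g_bounded: "\<exists>B. \<forall>p. cmod (complex_of_real (g p)) \<le> B"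
  using supported_bounded_integrable[of "\<lambda>p. complex_of_real (g p)", OF _ g_supp]
  by (auto intro!: continuous_intros g_continuous simp del: norm_of_real)

lemma shift_wave_integrable: "integrable lborel (shift y0 (wave po D))"
proof -
  have "integrable lborel (wave po D)" using D by (simp add: packet_conds_def)
  then have "integrable lborel (\<lambda>y. wave po D (- y0 + 1 * y))"
    by (intro lborel_integrable_real_affine) auto
  then show ?thesis by (simp add: shift_def[abs_def])
qed

lemma checkft_wave:
  assumes "k > 0"
  shows "checkft (shift y0 (wave po D)) k
    = complex_of_real (1 / (2 * pi)) * (LINT p|lborel. complex_of_real (g p) * cis (- (p * y0)) * beta_kernel p k)"
  unfolding wave_def
  by (rule checkft_eq_beta_kernel[OF g_integrable _ _ _ assms, of "po / 2" "3 * po / 2"])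
     (use g_supp po shift_wave_integrable[of y0] in \<open>auto simp: wave_def\<close>)

text \<open>The packet is integrable by condition (v), so Fourier inversion returns g; the
  translation contributes only a phase.\<close>

lemma FT_wave: "cmod (FT (shift y0 (wave po D)) p) = g p"
proof -
  obtain B where B: "\<And>p. cmod (complex_of_real (g p)) \<le> B" using g_bounded by blast
  let ?F = "\<lambda>s. LINT p|lborel. complex_of_real (g p) * cis (s * p)"
  have wF: "wave po D y = complex_of_real (1 / sqrt (2 * pi)) * ?F y" for y
    by (simp add: wave_def invFT_def mult.commute)
  have "integrable lborel (\<lambda>y. complex_of_real (sqrt (2 * pi)) * wave po D y)"
    using D by (intro integrable_mult_right) (simp add: packet_conds_def)
  then have F: "integrable lborel ?F" unfolding wF by (simp flip: mult.assoc of_real_mult)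
  have "(LINT y|lborel. wave po D (y - y0) * cis (- (p * y))) = (LINT y|lborel. wave po D y * cis (- (p * (y0 + y))))"
    using lborel_integral_real_affine[of 1 "\<lambda>y. wave po D (y - y0) * cis (- (p * y))" y0] by simp
  also have "\<dots> = (LINT y|lborel. (complex_of_real (1 / sqrt (2 * pi)) * cis (- (p * y0))) * (?F y * cis (- (y * p))))"
  proof -
    have "cis (- (p * (y0 + y))) = cis (- (p * y0)) * cis (- (y * p))" for y
      by (simp add: cis_mult algebra_simps)
    then show ?thesis unfolding wF by (simp add: mult_ac)
  qed
  also have "\<dots> = (complex_of_real (1 / sqrt (2 * pi)) * cis (- (p * y0))) * (complex_of_real (2 * pi) * complex_of_real (g p))"
    unfolding integral_mult_right_zero by (subst fourier_inversion[OF g_integrable g_cont B F]) simp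
  finally have "FT (shift y0 (wave po D)) p = complex_of_real (1 / sqrt (2 * pi)) * ((complex_of_real (1 / sqrt (2 * pi)) * cis (- (p * y0))) * (complex_of_real (2 * pi) * complex_of_real (g p)))"
    by (simp add: FT_def shift_def)
  also have "\<dots> = complex_of_real (1 / sqrt (2 * pi) * (1 / sqrt (2 * pi)) * (2 * pi)) * (cis (- (p * y0)) * complex_of_real (g p))"
    by (simp only: of_real_mult mult_ac)
  also have "1 / sqrt (2 * pi) * (1 / sqrt (2 * pi)) * (2 * pi) = 1" by simp
  finally have "cmod (FT (shift y0 (wave po D)) p) = \<bar>g p\<bar>" by (simp add: norm_mult)
  moreover have "g p \<ge> 0" using D_nonneg by (simp add: wave_ft_def)
  ultimately show ?thesis by simp
qed

end

section \<open>Real-variable estimates for the L2 splitting\<close>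

lemma integrable_exp_abs: "integrable lborel (\<lambda>s::real. exp (- (2 * \<bar>s\<bar>)))"
proof -
  have "integrable lborel (\<lambda>y. exp (2 * complex_of_real y - (2 + 2) * complex_of_real (ln (1 + exp y))))"
    by (rule Beta_exp_integral) auto
  then have "integrable lborel (\<lambda>y. 16 * exp (2 * complex_of_real y - (2 + 2) * complex_of_real (ln (1 + exp y))))"
    by simp
  then show ?thesis
  proof (rule Bochner_Integration.integrable_bound)
    \<comment> \<open>1 + exp y \<le> 2 exp (max y 0), whose fourth power gives the 16: the Beta
      integrand with both exponents 2 is the majorant.\<close>
    have "exp (- (2 * \<bar>y\<bar>)) \<le> 16 * exp (2 * y - 4 * ln (1 + exp y))" for y :: real
    proof -
      have "ln (1 + exp y) \<le> ln 2 + max y 0"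
      proof -
        have "1 + exp y \<le> 2 * exp (max y 0)" by (auto simp: max_def)
        then have "ln (1 + exp y) \<le> ln (2 * exp (max y 0))" by (subst ln_le_cancel_iff) (auto simp: add_pos_pos)
        then show ?thesis by (simp add: ln_mult)
      qed
      then have "- (2 * \<bar>y\<bar>) \<le> 4 * ln 2 + (2 * y - 4 * ln (1 + exp y))"
        by (auto simp: max_def abs_if split: if_splits)
      then have "exp (- (2 * \<bar>y\<bar>)) \<le> exp (4 * ln 2 + (2 * y - 4 * ln (1 + exp y)))" by simp
      also have "\<dots> = exp (4 * ln 2) * exp (2 * y - 4 * ln (1 + exp y))" by (rule exp_add)
      also have "exp (4 * ln 2) = (16::real)"
        using exp_of_nat_mult[of 4 "ln 2 :: real"] by simp
      finally show ?thesis .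
    qed
    then show "AE y in lborel. norm (exp (- (2 * \<bar>y\<bar>))) \<le> norm (16 * exp (2 * complex_of_real y - (2 + 2) * complex_of_real (ln (1 + exp y))))"
      by (simp add: norm_mult)
  qed simp
qed

lemma plancherel_has_bochner_integral:
  fixes G :: "real \<Rightarrow> complex"
  assumes G: "integrable lborel G" and cont: "continuous_on UNIV G" and B: "\<And>x. cmod (G x) \<le> B"
  shows "has_bochner_integral lborel (\<lambda>s. (cmod (LINT p|lborel. G p * cis (s * p)))\<^sup>2)
    (2 * pi * (LINT p|lborel. (cmod (G p))\<^sup>2))"
proof (rule has_bochner_integral_nn_integral[OF _ _ _ plancherel[OF assms]])
  have [measurable]: "G \<in> borel_measurable borel" using cont by (rule borel_measurable_continuous_onI)
  show "(\<lambda>s. (cmod (LINT p|lborel. G p * cis (s * p)))\<^sup>2) \<in> borel_measurable lborel" by measurable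
qed (auto intro!: mult_nonneg_nonneg integral_nonneg_AE)

text \<open>For y0 = 0 evenness gives exactly one half. A shift changes the domain only inside
  [-|y0|, |y0|], where q is at most m.\<close>

lemma half_line_integral_even:
  fixes q :: "real \<Rightarrow> real"
  assumes q: "integrable lborel q" and even: "\<And>s. q (- s) = q s" and bnd: "\<And>s. 0 \<le> q s" "\<And>s. q s \<le> m"
  shows "\<bar>(LINT s|lborel. indicator {0<..} s * q (s - y0)) - (LINT s|lborel. q s) / 2\<bar> \<le> 2 * m * \<bar>y0\<bar>"
proof -
  have ind: "integrable lborel (\<lambda>s. indicator A s * q s)" if "A \<in> sets borel" for A
    using integrable_real_mult_indicator[of A lborel q] that q by (simp add: mult.commute)
  have neg: "(LINT s|lborel. indicator {..<0} s * q s) = (LINT s|lborel. indicator {0<..} s * q s)"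
  proof -
    have "(LINT s|lborel. indicator {..<0} s * q s) = (LINT s|lborel. indicator {..<0} (0 + (-1) * s) * q (0 + (-1) * s))"
      using lborel_integral_real_affine[of "-1" "\<lambda>s. indicator {..<0} s * q s" 0] by simp
    also have "\<dots> = (LINT s|lborel. indicator {0<..} s * q s)"
      by (rule Bochner_Integration.integral_cong) (auto simp: even indicator_def)
    finally show ?thesis .
  qed
  have "(LINT s|lborel. q s) = (LINT s|lborel. indicator {..<0} s * q s + indicator {0<..} s * q s)"
  proof (rule integral_cong_AE)
    show "AE s in lborel. q s = indicator {..<0} s * q s + indicator {0<..} s * q s"
      using AE_lborel_singleton[of 0] by eventually_elim (auto simp: indicator_def)
  qed (use q in auto)
  also have "\<dots> = 2 * (LINT s|lborel. indicator {0<..} s * q s)"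
    by (subst Bochner_Integration.integral_add) (auto simp: neg intro!: ind)
  finally have half: "(LINT s|lborel. q s) / 2 = (LINT s|lborel. indicator {0<..} s * q s)" by simp
  have "(LINT s|lborel. indicator {0<..} s * q (s - y0)) = (LINT s|lborel. indicator {0<..} (y0 + s) * q s)"
    using lborel_integral_real_affine[of 1 "\<lambda>s. indicator {0<..} s * q (s - y0)" y0] by simp
  also have "\<dots> = (LINT s|lborel. indicator {- y0<..} s * q s)"
    by (rule Bochner_Integration.integral_cong) (auto simp: indicator_def)
  finally have "(LINT s|lborel. indicator {0<..} s * q (s - y0)) - (LINT s|lborel. q s) / 2
     = (LINT s|lborel. indicator {- y0<..} s * q s - indicator {0<..} s * q s)"
    unfolding half by (simp add: ind)
  also have "\<bar>\<dots>\<bar> \<le> (LINT s|lborel. \<bar>indicator {- y0<..} s * q s - indicator {0<..} s * q s\<bar>)"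
    by (rule integral_abs_bound)
  also have "\<dots> \<le> (LINT s|lborel. m * indicator {- \<bar>y0\<bar>..\<bar>y0\<bar>} s)"
  proof (rule integral_mono)
    have m0: "0 \<le> m" using bnd order_trans by blast
    then show "\<bar>indicator {- y0<..} s * q s - indicator {0<..} s * q s\<bar> \<le> m * indicator {- \<bar>y0\<bar>..\<bar>y0\<bar>} s" for s
      using bnd[of s] by (auto simp: indicator_def)
    show "integrable lborel (\<lambda>s. m * indicator {- \<bar>y0\<bar>..\<bar>y0\<bar>} s)"
      by (intro integrable_mult_right integrable_real_indicator) auto
  qed (intro integrable_abs Bochner_Integration.integrable_diff ind; simp)
  also have "\<dots> = 2 * m * \<bar>y0\<bar>" by simp
  finally show ?thesis .
qed

text \<open>The cross term 2 Re (a cnj b) is split with a free weight t: a small multiple of |a|^2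
  is paid for by 1 / t times |b|^2.\<close>

lemma cmod_square_perturbation:
  fixes a b :: complex
  assumes "t > 0"
  shows "\<bar>(cmod (a + b))\<^sup>2 - (cmod a)\<^sup>2\<bar> \<le> t * (cmod a)\<^sup>2 + (1 + 1 / t) * (cmod b)\<^sup>2"
proof -
  have amgm: "2 * (cmod a * cmod b) \<le> t * (cmod a)\<^sup>2 + (cmod b)\<^sup>2 / t"
  proof -
    have "0 \<le> (t * cmod a - cmod b)\<^sup>2 / t" using assms by simp
    then show ?thesis using assms by (simp add: power2_diff power2_eq_square field_simps)
  qed
  have "(cmod (a + b))\<^sup>2 = (cmod a)\<^sup>2 + (cmod b)\<^sup>2 + 2 * Re (a * cnj b)"
    unfolding cmod_power2 by (simp add: power2_eq_square algebra_simps)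
  moreover have "\<bar>Re (a * cnj b)\<bar> \<le> cmod a * cmod b"
    using abs_Re_le_cmod[of "a * cnj b"] by (simp add: norm_mult)
  moreover have "(1 + 1 / t) * (cmod b)\<^sup>2 = (cmod b)\<^sup>2 + (cmod b)\<^sup>2 / t" by (simp add: algebra_simps)
  ultimately show ?thesis using amgm zero_le_power2[of "cmod b"] by linarith
qed

section \<open>Two-sided estimate of the particle number at fixed \<delta>\<close>

context packet begin

text \<open>In the variable \<open>s = ln k\<close> the transform is split as \<open>\<psi> = a + b\<close>: \<open>a\<close> is the leading part on \<open>s > 0\<close> with the
  amplitude frozen at \<open>po\<close>, and \<open>b\<close> is small in \<open>L\<^sup>2\<close>. The parameter \<open>r\<close> is independent of \<open>\<delta>\<close> and also serves as
  the weight in the AM-GM bound of the cross term; it goes to \<open>0\<close> only after \<open>\<delta>\<close>.\<close>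

lemma Nbar_estimate:
  fixes y0 C r :: real
  defines "c0 \<equiv> complex_of_real (sqrt (2 * po)) * beta_amplitude po"
  defines "L \<equiv> (cmod c0)\<^sup>2 / (8 * pi)" and "M \<equiv> (cmod c0)\<^sup>2 * \<bar>y0\<bar> / (2 * pi\<^sup>2)"
    and "R \<equiv> 2 * pi + 2 * (sqrt (3 * po) * C / (2 * pi))\<^sup>2 * (LINT s|lborel. exp (- (2 * \<bar>s\<bar>)))"
  assumes C: "C \<ge> 0"
    and small: "\<And>p k. p \<in> {po / 2..3 * po / 2} \<Longrightarrow> 0 < k \<Longrightarrow> k \<le> 1 \<Longrightarrow> cmod (beta_kernel p k) \<le> C * k"
    and large: "\<And>p k. p \<in> {po / 2..3 * po / 2} \<Longrightarrow> k \<ge> 1 \<Longrightarrow> cmod (beta_kernel p k - beta_amplitude p * cis (p * ln k)) \<le> C / k"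
    and r: "r > 0" "\<delta> \<le> r\<^sup>2"
    and close: "\<And>p. p \<in> {po - \<delta>..po + \<delta>} \<Longrightarrow> cmod (complex_of_real (sqrt (2 * p)) * beta_amplitude p - c0) \<le> r"
  obtains n where "n \<ge> 0" "Nbar (shift y0 (wave po D)) = ennreal n"
    "\<bar>n - L\<bar> \<le> M * r\<^sup>2 + r * (L + M * r\<^sup>2) + (r\<^sup>2 + r) * R"
proof -
  define J where "J = (LINT s|lborel. exp (- (2 * \<bar>s\<bar>)) :: real)"
  define K where "K = sqrt (3 * po) * C / (2 * pi)"
  have K0: "K \<ge> 0" using C po by (simp add: K_def)
  have J0: "J \<ge> 0" unfolding J_def by (intro integral_nonneg_AE) auto
  define W where "W = (LINT p|lborel. Dp p)"
  have W0: "W \<ge> 0" using Dp_integral by (simp add: W_def)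
  have W2: "W\<^sup>2 \<le> 2 * \<delta>"
    using power_mono[OF Dp_integral(2) Dp_integral(1), of 2] \<delta> by (simp add: W_def)
  define f where "f = shift y0 (wave po D)"
  have [measurable]: "f \<in> borel_measurable borel"
    using borel_measurable_integrable[OF shift_wave_integrable[of y0]] by (simp add: f_def)
  have [measurable]: "xmap \<in> borel_measurable borel" unfolding xmap_def[abs_def] by measurable
  define \<psi> where "\<psi> s = checkft f (exp s)" for s
  have ck_meas [measurable]: "checkft f \<in> borel_measurable borel" unfolding checkft_def[abs_def] by measurable
  have [measurable]: "\<psi> \<in> borel_measurable borel" unfolding \<psi>_def[abs_def] by measurable
  define Dh where "Dh s = (LINT p|lborel. complex_of_real (Dp p) * cis (s * p))" for s
  have [measurable]: "Dh \<in> borel_measurable borel" unfolding Dh_def[abs_def] by measurable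
  define Eu where "Eu p = complex_of_real (sqrt (2 * p)) * beta_amplitude p - c0" for p
  have Eu_cont: "continuous_on {0<..} Eu"
    unfolding Eu_def[abs_def] by (intro continuous_intros continuous_on_beta_amplitude)
  have [measurable]: "(\<lambda>p. Eu p * complex_of_real (Dp p)) \<in> borel_measurable borel"
    using mult_Dp(1)[OF Eu_cont] by (rule borel_measurable_continuous_onI)
  define Eh where "Eh s = (LINT p|lborel. (Eu p * complex_of_real (Dp p)) * cis (s * p))" for s
  have [measurable]: "Eh \<in> borel_measurable borel" unfolding Eh_def[abs_def] by measurable
  \<comment> \<open>The phases exp (-\<i> p y0) and exp (\<i> p s) combine, so y0 only shifts the
    argument of \<open>Dh\<close>.\<close>
  define a where "a s = indicator {0<..} s *\<^sub>R (complex_of_real (1 / (2 * pi)) * (c0 * Dh (s - y0)))" for s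
  have [measurable]: "a \<in> borel_measurable borel" unfolding a_def[abs_def] by measurable
  define b where "b s = \<psi> s - a s" for s
  have [measurable]: "b \<in> borel_measurable borel" unfolding b_def[abs_def] by measurable

  have kern_int: "integrable lborel (\<lambda>p. complex_of_real (g p) * cis (- (p * y0)) * beta_kernel p k)" if k: "k > 0" for k
  proof -
    have "integrable lborel (\<lambda>p. (complex_of_real (sqrt (2 * p)) * cis (- (p * y0)) * beta_kernel p k) * complex_of_real (Dp p))"
      unfolding beta_kernel_def using k
      by (intro mult_Dp continuous_intros) (auto intro!: not_nonpos_Int_if_Im)
    then show ?thesis by (simp add: g_eq mult_ac)
  qed
  \<comment> \<open>On the support p \<le> 3 po / 2, so sqrt (2p) \<le> sqrt (3 po).\<close>
  have gb: "g p * x \<le> sqrt (3 * po) * Dp p * y" if "Dp p \<noteq> 0 \<Longrightarrow> x \<le> y" "0 \<le> y" for p x y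
  proof (cases "Dp p = 0")
    case False
    then have "sqrt (2 * p) \<le> sqrt (3 * po)" using Dp_supp'[OF False] by auto
    then have "sqrt (2 * p) * Dp p * x \<le> sqrt (3 * po) * Dp p * y"
      using that False D_nonneg[of "p - po"] Dp_supp'[OF False] po 
      by (intro mult_mono' mult_nonneg_nonneg order_trans[OF mult_left_mono mult_right_mono] mult_right_mono) auto
    then show ?thesis by (simp add: g_eq)
  qed (simp add: g_eq)
  have g0: "g p \<ge> 0" for p using D_nonneg by (simp add: wave_ft_def)

  have b_bound: "cmod (b s) \<le> cmod (Eh (s - y0)) + K * W * exp (- \<bar>s\<bar>)" for s
  proof (cases "s \<le> 0")
    case True
    have "cmod (LINT p|lborel. complex_of_real (g p) * cis (- (p * y0)) * beta_kernel p (exp s))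
      \<le> (LINT p|lborel. sqrt (3 * po) * Dp p * (C * exp s))"
    proof (rule Bochner_Integration.integral_norm_bound_integral)
      show "integrable lborel (\<lambda>p. complex_of_real (g p) * cis (- (p * y0)) * beta_kernel p (exp s))"
        by (rule kern_int) simp
      show "integrable lborel (\<lambda>p. sqrt (3 * po) * Dp p * (C * exp s))"
        using Dp_integrable by simp
      show "norm (complex_of_real (g p) * cis (- (p * y0)) * beta_kernel p (exp s)) \<le> sqrt (3 * po) * Dp p * (C * exp s)" for p
        using gb[of p "cmod (beta_kernel p (exp s))" "C * exp s"] small[OF Dp_supp', of p "exp s"] True C g0[of p]
        by (simp add: norm_mult)
    qed
    also have "\<dots> = sqrt (3 * po) * C * W * exp s" by (simp add: W_def)
    finally have "cmod (\<psi> s) \<le> 1 / (2 * pi) * (sqrt (3 * po) * C * W * exp s)"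
      unfolding \<psi>_def f_def by (subst checkft_wave) (simp_all add: norm_mult norm_divide divide_right_mono)
    then show ?thesis using True by (simp add: b_def a_def K_def add_increasing)
  next
    case False
    then have s: "s > 0" by simp
    define rest where "rest p = complex_of_real (g p) * cis (- (p * y0)) * (beta_kernel p (exp s) - beta_amplitude p * cis (p * s))" for p
    \<comment> \<open>Three parts: the error of the large-k expansion, the error of freezing the
      amplitude at po, and the leading term that \<open>a\<close> removes.\<close>
    have split: "complex_of_real (g p) * cis (- (p * y0)) * beta_kernel p (exp s)
       = rest p + ((Eu p * complex_of_real (Dp p)) * cis ((s - y0) * p) + c0 * (complex_of_real (Dp p) * cis ((s - y0) * p)))" for p
    proof -
      have "cis ((s - y0) * p) = cis (- (p * y0)) * cis (p * s)"
        by (simp add: cis_mult algebra_simps)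
      then show ?thesis
        unfolding rest_def g_eq Eu_def by (simp add: algebra_simps)
    qed
    have i1: "integrable lborel (\<lambda>p. (Eu p * complex_of_real (Dp p)) * cis ((s - y0) * p))"
      by (rule Bochner_Integration.integrable_bound[OF mult_Dp(2)[OF Eu_cont]]) (auto simp: norm_mult)
    have i2: "integrable lborel (\<lambda>p. complex_of_real (Dp p) * cis ((s - y0) * p))"
      by (rule Bochner_Integration.integrable_bound[OF Dp_integrable]) (auto simp: norm_mult)
    have i3: "integrable lborel rest"
    proof -
      have "rest = (\<lambda>p. complex_of_real (g p) * cis (- (p * y0)) * beta_kernel p (exp s)
        - ((Eu p * complex_of_real (Dp p)) * cis ((s - y0) * p) + c0 * (complex_of_real (Dp p) * cis ((s - y0) * p))))"
        unfolding split by simp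
      then show ?thesis
        using kern_int[of "exp s"] i1 i2 by simp
    qed
    have "(LINT p|lborel. complex_of_real (g p) * cis (- (p * y0)) * beta_kernel p (exp s))
      = (LINT p|lborel. rest p) + (Eh (s - y0) + c0 * Dh (s - y0))"
      unfolding split Eh_def Dh_def using i1 i2 i3 by simp
    then have "\<psi> s = complex_of_real (1 / (2 * pi)) * ((LINT p|lborel. rest p) + (Eh (s - y0) + c0 * Dh (s - y0)))"
      unfolding \<psi>_def f_def by (subst checkft_wave) simp_all
    then have "b s = complex_of_real (1 / (2 * pi)) * (LINT p|lborel. rest p) + complex_of_real (1 / (2 * pi)) * Eh (s - y0)"
      using s by (simp add: b_def a_def algebra_simps)
    then have "cmod (b s) \<le> 1 / (2 * pi) * cmod (LINT p|lborel. rest p) + 1 / (2 * pi) * cmod (Eh (s - y0))"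
      by (metis (no_types, lifting) norm_triangle_ineq norm_mult norm_of_real abs_of_nonneg divide_nonneg_nonneg pi_ge_zero zero_le_one mult_nonneg_nonneg zero_le_numeral)
    also have "cmod (LINT p|lborel. rest p) \<le> (LINT p|lborel. sqrt (3 * po) * Dp p * (C * exp (- s)))"
    proof (rule Bochner_Integration.integral_norm_bound_integral[OF i3])
      show "integrable lborel (\<lambda>p. sqrt (3 * po) * Dp p * (C * exp (- s)))"
        using Dp_integrable by simp
      show "norm (rest p) \<le> sqrt (3 * po) * Dp p * (C * exp (- s))" for p
        using gb[of p "cmod (beta_kernel p (exp s) - beta_amplitude p * cis (p * s))" "C * exp (- s)"]
          large[OF Dp_supp', of p "exp s"] s C g0[of p]
        by (simp add: rest_def norm_mult exp_minus divide_inverse)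
    qed
    also have "(LINT p|lborel. sqrt (3 * po) * Dp p * (C * exp (- s))) = sqrt (3 * po) * C * W * exp (- s)"
      by (simp add: W_def)
    also have "1 / (2 * pi) * cmod (Eh (s - y0)) \<le> 1 * cmod (Eh (s - y0))"
      using pi_ge_two by (intro mult_right_mono) auto
    finally show ?thesis using s by (simp add: K_def divide_right_mono)
  qed

  \<comment> \<open>The two terms are small for different reasons: the first by Plancherel, the
    second because W^2 \<le> 2\<delta>.\<close>
  define B2 where "B2 s = 2 * (cmod (Eh (s - y0)))\<^sup>2 + 2 * (K * W)\<^sup>2 * exp (- (2 * \<bar>s\<bar>))" for s
  have b2: "(cmod (b s))\<^sup>2 \<le> B2 s" for s
  proof -
    have "(cmod (b s))\<^sup>2 \<le> (cmod (Eh (s - y0)) + K * W * exp (- \<bar>s\<bar>))\<^sup>2"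
      by (intro power_mono b_bound) auto
    also have "\<dots> \<le> 2 * (cmod (Eh (s - y0)))\<^sup>2 + 2 * (K * W * exp (- \<bar>s\<bar>))\<^sup>2"
      using sum_squares_bound[of "cmod (Eh (s - y0))" "K * W * exp (- \<bar>s\<bar>)"] by (simp add: power2_sum)
    also have "(K * W * exp (- \<bar>s\<bar>))\<^sup>2 = (K * W)\<^sup>2 * exp (- (2 * \<bar>s\<bar>))"
      by (simp add: power_mult_distrib flip: exp_of_nat_mult)
    finally show ?thesis by (simp add: B2_def)
  qed
  have D_int: "has_bochner_integral lborel (\<lambda>s. (cmod (Dh s))\<^sup>2) (2 * pi)"
  proof -
    obtain B where B: "\<And>p. cmod (1 * complex_of_real (Dp p)) \<le> B" using mult_Dp(4)[of "\<lambda>_. 1"] by auto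
    show ?thesis
      using plancherel_has_bochner_integral[OF mult_Dp(2,1)[of "\<lambda>_. 1"] B] Dp_square(2)
      by (simp add: Dh_def)
  qed
  \<comment> \<open>Plancherel turns the bound r for \<open>Eu\<close> on the support into an L2
    bound, since D has L2 norm 1.\<close>
  have E_int: "integrable lborel (\<lambda>s. (cmod (Eh s))\<^sup>2)" "(LINT s|lborel. (cmod (Eh s))\<^sup>2) \<le> 2 * pi * r\<^sup>2"
  proof -
    obtain B where B: "\<And>p. cmod (Eu p * complex_of_real (Dp p)) \<le> B" using mult_Dp(4)[OF Eu_cont] by auto
    have hb: "has_bochner_integral lborel (\<lambda>s. (cmod (Eh s))\<^sup>2) (2 * pi * (LINT p|lborel. (cmod (Eu p * complex_of_real (Dp p)))\<^sup>2))"
      using plancherel_has_bochner_integral[OF mult_Dp(2,1)[OF Eu_cont] B] by (simp add: Eh_def)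
    then show "integrable lborel (\<lambda>s. (cmod (Eh s))\<^sup>2)" by (simp add: has_bochner_integral_iff)
    have "(LINT p|lborel. (cmod (Eu p * complex_of_real (Dp p)))\<^sup>2) \<le> (LINT p|lborel. r\<^sup>2 * (Dp p)\<^sup>2)"
    proof (rule integral_mono)
      show "(cmod (Eu p * complex_of_real (Dp p)))\<^sup>2 \<le> r\<^sup>2 * (Dp p)\<^sup>2" for p
      proof (cases "Dp p = 0")
        case False
        then have "cmod (Eu p) \<le> r" unfolding Eu_def using Dp_supp[of p] by (intro close) auto
        then show ?thesis by (simp add: norm_mult power_mult_distrib mult_right_mono power_mono)
      qed simp
    qed (use mult_Dp(3)[OF Eu_cont] Dp_square(1) in auto)
    also have "\<dots> = r\<^sup>2" using Dp_square(2) by simp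
    finally have "2 * pi * (LINT p|lborel. (cmod (Eu p * complex_of_real (Dp p)))\<^sup>2) \<le> 2 * pi * r\<^sup>2"
      by (intro mult_left_mono) auto
    then show "(LINT s|lborel. (cmod (Eh s))\<^sup>2) \<le> 2 * pi * r\<^sup>2"
      using has_bochner_integral_integral_eq[OF hb] by simp
  qed
  define H where "H = (LINT s|lborel. indicator {0<..} s * (cmod (Dh (s - y0)))\<^sup>2)"
  have Dq: "integrable lborel (\<lambda>s. (cmod (Dh s))\<^sup>2)" "(LINT s|lborel. (cmod (Dh s))\<^sup>2) = 2 * pi"
    using D_int by (auto simp: has_bochner_integral_iff)
  \<comment> \<open>The Plancherel mass is 2 pi, hence pi on a half line from 0; the sup bound W^2
    \<le> 2\<delta> \<le> 2 r^2 controls the shift by y0.\<close>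
  have H: "\<bar>H - pi\<bar> \<le> 4 * r\<^sup>2 * \<bar>y0\<bar>"
  proof -
    have "cmod (Dh s) \<le> W" for s
      unfolding Dh_def W_def using D_nonneg
      by (intro order_trans[OF integral_norm_bound]) (simp add: norm_mult)
    then have "(cmod (Dh s))\<^sup>2 \<le> 2 * \<delta>" for s
      using power_mono[of "cmod (Dh s)" W 2] W2 by (meson norm_ge_zero order_trans)
    moreover have "cmod (Dh (- s)) = cmod (Dh s)" for s
    proof -
      have "Dh (- s) = cnj (Dh s)"
        unfolding Dh_def using Bochner_Integration.integral_cnj[of lborel "\<lambda>p. complex_of_real (Dp p) * cis (s * p)"]
        by (simp add: cis_cnj)
      then show ?thesis by simp
    qed
    ultimately have "\<bar>H - (LINT s|lborel. (cmod (Dh s))\<^sup>2) / 2\<bar> \<le> 2 * (2 * \<delta>) * \<bar>y0\<bar>"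
      unfolding H_def by (intro half_line_integral_even Dq) auto
    also have "\<dots> \<le> 4 * r\<^sup>2 * \<bar>y0\<bar>" using r by (intro mult_right_mono) auto
    finally show ?thesis unfolding Dq by simp
  qed
  have a2: "(cmod (a s))\<^sup>2 = (cmod c0)\<^sup>2 / (4 * pi\<^sup>2) * (indicator {0<..} s * (cmod (Dh (s - y0)))\<^sup>2)" for s
    by (simp add: a_def norm_mult norm_divide power_mult_distrib power_divide indicator_def)
  have a_int: "integrable lborel (\<lambda>s. (cmod (a s))\<^sup>2)"
  proof -
    have "integrable lborel (\<lambda>s. (cmod (Dh (- y0 + 1 * s)))\<^sup>2)"
      by (rule lborel_integrable_real_affine[OF Dq(1)]) simp
    then have "integrable lborel (\<lambda>s. (cmod (Dh (s - y0)))\<^sup>2 * indicator {0<..} s)"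
      by (intro integrable_real_mult_indicator) auto
    then show ?thesis unfolding a2 by (simp add: mult.commute)
  qed
  \<comment> \<open>The division by 2 here, in \<open>B\<close> and in \<open>n\<close> is that of
    dk / (2k).\<close>
  define A where "A = (LINT s|lborel. (cmod (a s))\<^sup>2) / 2"
  have "A = (cmod c0)\<^sup>2 / (8 * pi\<^sup>2) * H"
    unfolding A_def a2 H_def by simp
  then have "A - L = (cmod c0)\<^sup>2 / (8 * pi\<^sup>2) * (H - pi)"
    unfolding L_def by (simp add: right_diff_distrib power2_eq_square)
  then have "\<bar>A - L\<bar> = (cmod c0)\<^sup>2 / (8 * pi\<^sup>2) * \<bar>H - pi\<bar>"
    by (simp add: abs_mult)
  also have "\<dots> \<le> (cmod c0)\<^sup>2 / (8 * pi\<^sup>2) * (4 * r\<^sup>2 * \<bar>y0\<bar>)"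
    by (intro mult_left_mono H) auto
  also have "\<dots> = M * r\<^sup>2" by (simp add: M_def)
  finally have AL: "\<bar>A - L\<bar> \<le> M * r\<^sup>2" .

  have Es: "integrable lborel (\<lambda>s. (cmod (Eh (s - y0)))\<^sup>2)" "(LINT s|lborel. (cmod (Eh (s - y0)))\<^sup>2) = (LINT s|lborel. (cmod (Eh s))\<^sup>2)"
    using lborel_integrable_real_affine[OF E_int(1), of 1 "- y0"] lborel_integral_real_affine[of 1 "\<lambda>s. (cmod (Eh s))\<^sup>2" "- y0"]
    by simp_all
  have B2_int: "integrable lborel B2"
    unfolding B2_def[abs_def] using Es integrable_exp_abs by (intro Bochner_Integration.integrable_add integrable_mult_right)
  have b_int: "integrable lborel (\<lambda>s. (cmod (b s))\<^sup>2)"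
    by (rule Bochner_Integration.integrable_bound[OF B2_int]) (use b2 in \<open>auto intro: order_trans[OF _ abs_ge_self]\<close>)
  define B where "B = (LINT s|lborel. (cmod (b s))\<^sup>2) / 2"
  have "B \<le> (LINT s|lborel. B2 s) / 2"
    unfolding B_def by (intro divide_right_mono integral_mono b_int B2_int b2) auto
  also have "\<dots> = (LINT s|lborel. (cmod (Eh s))\<^sup>2) + K\<^sup>2 * W\<^sup>2 * J"
    unfolding B2_def J_def using Es integrable_exp_abs
    by (subst Bochner_Integration.integral_add) (auto simp: power_mult_distrib add_divide_distrib)
  also have "\<dots> \<le> 2 * pi * r\<^sup>2 + K\<^sup>2 * (2 * r\<^sup>2) * J"
    using W2 r J0 by (intro add_mono E_int mult_right_mono mult_left_mono) auto
  also have "\<dots> = r\<^sup>2 * R" by (simp add: R_def J_def K_def algebra_simps)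
  finally have BR: "B \<le> r\<^sup>2 * R" .

  have pert: "\<bar>(cmod (\<psi> s))\<^sup>2 - (cmod (a s))\<^sup>2\<bar> \<le> t * (cmod (a s))\<^sup>2 + (1 + 1 / t) * (cmod (b s))\<^sup>2" if "t > 0" for s t
    using cmod_square_perturbation[OF that, of "a s" "b s"] by (simp add: b_def)
  have psi_int: "integrable lborel (\<lambda>s. (cmod (\<psi> s))\<^sup>2)"
  proof (rule Bochner_Integration.integrable_bound)
    show "integrable lborel (\<lambda>s. 2 * (cmod (a s))\<^sup>2 + 2 * (cmod (b s))\<^sup>2)"
      using a_int b_int by simp
    show "AE s in lborel. norm ((cmod (\<psi> s))\<^sup>2) \<le> norm (2 * (cmod (a s))\<^sup>2 + 2 * (cmod (b s))\<^sup>2)"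
    proof (rule AE_I2)
      fix s
      have "(cmod (\<psi> s))\<^sup>2 \<le> 2 * (cmod (a s))\<^sup>2 + 2 * (cmod (b s))\<^sup>2"
        using pert[of 1 s] unfolding abs_le_iff by simp
      then show "norm ((cmod (\<psi> s))\<^sup>2) \<le> norm (2 * (cmod (a s))\<^sup>2 + 2 * (cmod (b s))\<^sup>2)"
        by simp
    qed
  qed simp
  define n where "n = (LINT s|lborel. (cmod (\<psi> s))\<^sup>2) / 2"
  \<comment> \<open>The choice t = r balances the terms: \<open>B\<close> is O(r^2), so B / r is
    still O(r).\<close>
  have "\<bar>n - A\<bar> = \<bar>LINT s|lborel. (cmod (\<psi> s))\<^sup>2 - (cmod (a s))\<^sup>2\<bar> / 2"
    unfolding n_def A_def using psi_int a_int by (simp add: diff_divide_distrib[symmetric])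
  also have "\<dots> \<le> (LINT s|lborel. r * (cmod (a s))\<^sup>2 + (1 + 1 / r) * (cmod (b s))\<^sup>2) / 2"
  proof (intro divide_right_mono order_trans[OF integral_abs_bound] integral_mono pert r)
    show "integrable lborel (\<lambda>s. \<bar>(cmod (\<psi> s))\<^sup>2 - (cmod (a s))\<^sup>2\<bar>)"
      using psi_int a_int by (intro integrable_abs Bochner_Integration.integrable_diff)
    show "integrable lborel (\<lambda>s. r * (cmod (a s))\<^sup>2 + (1 + 1 / r) * (cmod (b s))\<^sup>2)"
      using a_int b_int by (intro Bochner_Integration.integrable_add integrable_mult_right)
  qed simp
  also have "\<dots> = r * A + (1 + 1 / r) * B"
    unfolding A_def B_def using a_int b_int
    by (subst Bochner_Integration.integral_add) (auto simp: add_divide_distrib)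
  also have "\<dots> \<le> r * (L + M * r\<^sup>2) + (1 + 1 / r) * (r\<^sup>2 * R)"
    using AL r BR by (intro add_mono mult_left_mono) auto
  also have "(1 + 1 / r) * (r\<^sup>2 * R) = (r\<^sup>2 + r) * R"
    using r by (simp add: field_simps power2_eq_square)
  finally have nA: "\<bar>n - A\<bar> \<le> r * (L + M * r\<^sup>2) + (r\<^sup>2 + r) * R" .
  show thesis
  proof (rule that)
    show "0 \<le> n" unfolding n_def by (intro divide_nonneg_nonneg integral_nonneg_AE) auto
    show "\<bar>n - L\<bar> \<le> M * r\<^sup>2 + r * (L + M * r\<^sup>2) + (r\<^sup>2 + r) * R"
      using AL nA by linarith
    have "Nbar f = (\<integral>\<^sup>+k. ennreal ((cmod (\<psi> (ln k)))\<^sup>2 / 2 / k) * indicator {0<..} k \<partial>lborel)"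
      unfolding Nbar_def by (intro nn_integral_cong) (auto simp: \<psi>_def indicator_def)
    also have "\<dots> = (\<integral>\<^sup>+s. ennreal ((cmod (\<psi> s))\<^sup>2 / 2) \<partial>lborel)"
      by (rule nn_integral_ln_substitution) auto
    also have "\<dots> = ennreal (LINT s|lborel. (cmod (\<psi> s))\<^sup>2 / 2)"
      using psi_int by (intro nn_integral_eq_integral) auto
    finally show "Nbar (shift y0 (wave po D)) = ennreal n"
      by (simp add: n_def f_def)
  qed
qed

end

section \<open>The thermal particle number\<close>

context packet begin

text \<open>The factor 2p cancels, so the thermal number is the mean of the decreasing Planck factor
  under the probability density (D (p - po))^2, which lives within distance \<delta> of po.\<close>

lemma NTh_bounds:
  "1 / (exp (2 * pi * (po + \<delta>)) - 1) \<le> enn2real (NTh (shift y0 (wave po D)))"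
  "enn2real (NTh (shift y0 (wave po D))) \<le> 1 / (exp (2 * pi * (po - \<delta>)) - 1)"
proof -
  define w where "w p = 1 / (exp (2 * pi * p) - 1)" for p :: real
  have [measurable]: "w \<in> borel_measurable borel" unfolding w_def[abs_def] by measurable
  have w_mono: "w q \<le> w p" "0 < w q" if "0 < p" "p \<le> q" for p q
  proof -
    have "1 < exp (2 * pi * p)" "1 < exp (2 * pi * q)" "exp (2 * pi * p) \<le> exp (2 * pi * q)" using that by auto
    then show "w q \<le> w p" "0 < w q" unfolding w_def by (auto intro!: divide_left_mono mult_pos_pos)
  qed
  have lo: "w (po + \<delta>) * (Dp p)\<^sup>2 \<le> w p * (Dp p)\<^sup>2" and hi: "w p * (Dp p)\<^sup>2 \<le> w (po - \<delta>) * (Dp p)\<^sup>2" for p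
  proof -
    have "w (po + \<delta>) \<le> w p \<and> w p \<le> w (po - \<delta>)" if "Dp p \<noteq> 0"
      using Dp_supp[OF that] \<delta> po by (auto intro!: w_mono)
    then show "w (po + \<delta>) * (Dp p)\<^sup>2 \<le> w p * (Dp p)\<^sup>2" "w p * (Dp p)\<^sup>2 \<le> w (po - \<delta>) * (Dp p)\<^sup>2"
      by (cases "Dp p = 0"; simp add: mult_right_mono)+
  qed
  have nonneg: "0 \<le> w p * (Dp p)\<^sup>2" for p
    by (rule order_trans[OF _ lo]) (use w_mono(2)[of po "po + \<delta>"] po \<delta> in simp)
  have int: "integrable lborel (\<lambda>p. w p * (Dp p)\<^sup>2)"
  proof (rule Bochner_Integration.integrable_bound)
    show "integrable lborel (\<lambda>p. w (po - \<delta>) * (Dp p)\<^sup>2)" using Dp_square(1) by simp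
    show "AE p in lborel. norm (w p * (Dp p)\<^sup>2) \<le> norm (w (po - \<delta>) * (Dp p)\<^sup>2)"
      using hi nonneg by (auto intro!: AE_I2 simp del: norm_mult abs_mult intro: order_trans[OF _ abs_ge_self])
  qed simp
  have "NTh (shift y0 (wave po D)) = (\<integral>\<^sup>+p. ennreal (w p * (Dp p)\<^sup>2) \<partial>lborel)"
    unfolding NTh_def FT_wave
  proof (intro nn_integral_cong)
    fix p
    show "ennreal ((g p)\<^sup>2 / (2 * p) / (exp (2 * pi * p) - 1)) * indicator {0<..} p = ennreal (w p * (Dp p)\<^sup>2)"
    proof (cases "p > 0")
      case True
      then show ?thesis by (simp add: g_eq w_def power_mult_distrib)
    next
      case False
      then have "Dp p = 0" using Dp_supp'[of p] po by auto
      then show ?thesis using False by simp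
    qed
  qed
  also have "\<dots> = ennreal (LINT p|lborel. w p * (Dp p)\<^sup>2)"
    using nonneg by (intro nn_integral_eq_integral int) auto
  finally have eq: "enn2real (NTh (shift y0 (wave po D))) = (LINT p|lborel. w p * (Dp p)\<^sup>2)"
    using nonneg by (simp add: integral_nonneg_AE)
  have "(LINT p|lborel. w (po + \<delta>) * (Dp p)\<^sup>2) \<le> (LINT p|lborel. w p * (Dp p)\<^sup>2)"
    using Dp_square(1) by (intro integral_mono int lo) auto
  then show "1 / (exp (2 * pi * (po + \<delta>)) - 1) \<le> enn2real (NTh (shift y0 (wave po D)))"
    unfolding eq using Dp_square(2) by (simp add: w_def)
  have "(LINT p|lborel. w p * (Dp p)\<^sup>2) \<le> (LINT p|lborel. w (po - \<delta>) * (Dp p)\<^sup>2)"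
    using Dp_square(1) by (intro integral_mono int hi) auto
  then show "enn2real (NTh (shift y0 (wave po D))) \<le> 1 / (exp (2 * pi * (po - \<delta>)) - 1)"
    unfolding eq using Dp_square(2) by (simp add: w_def)
qed

end

section \<open>The limit of narrow packets\<close>

lemma NTh_limit:
  assumes po: "po > 0" and D: "\<And>\<delta>. 0 < \<delta> \<Longrightarrow> \<delta> \<le> po \<Longrightarrow> packet_conds po \<delta> (\<Delta> \<delta>)"
  shows "((\<lambda>\<delta>. enn2real (NTh (shift y0 (wave po (\<Delta> \<delta>))))) \<longlongrightarrow> 1 / (exp (2 * pi * po) - 1)) (at_right 0)"
proof (rule tendsto_sandwich)
  have ev: "\<forall>\<^sub>F \<delta> in at_right 0. \<delta> \<in> {0<..<po / 2}" using po by (intro eventually_at_right_real) auto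
  then have packet: "\<forall>\<^sub>F \<delta> in at_right 0. packet po \<delta> (\<Delta> \<delta>)"
    by eventually_elim (use po D in \<open>auto simp: packet_def\<close>)
  show "\<forall>\<^sub>F \<delta> in at_right 0. 1 / (exp (2 * pi * (po + \<delta>)) - 1) \<le> enn2real (NTh (shift y0 (wave po (\<Delta> \<delta>))))"
    using packet by eventually_elim (rule packet.NTh_bounds)
  show "\<forall>\<^sub>F \<delta> in at_right 0. enn2real (NTh (shift y0 (wave po (\<Delta> \<delta>)))) \<le> 1 / (exp (2 * pi * (po - \<delta>)) - 1)"
    using packet by eventually_elim (rule packet.NTh_bounds)
  have "((\<lambda>\<delta>. 1 / (exp (2 * pi * (po + \<delta>)) - 1)) \<longlongrightarrow> 1 / (exp (2 * pi * (po + 0)) - 1)) (at_right 0)"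
    using po by (intro tendsto_intros) auto
  then show "((\<lambda>\<delta>. 1 / (exp (2 * pi * (po + \<delta>)) - 1)) \<longlongrightarrow> 1 / (exp (2 * pi * po) - 1)) (at_right 0)" by simp
  have "((\<lambda>\<delta>. 1 / (exp (2 * pi * (po - \<delta>)) - 1)) \<longlongrightarrow> 1 / (exp (2 * pi * (po - 0)) - 1)) (at_right 0)"
    using po by (intro tendsto_intros) auto
  then show "((\<lambda>\<delta>. 1 / (exp (2 * pi * (po - \<delta>)) - 1)) \<longlongrightarrow> 1 / (exp (2 * pi * po) - 1)) (at_right 0)" by simp
qed

text \<open>For fixed r the estimate holds for all small \<delta> with a bound \<open>Q r\<close>
  free of \<delta>; afterwards r tends to 0.\<close>

lemma Nbar_limit:
  assumes po: "po > 0" and D: "\<And>\<delta>. 0 < \<delta> \<Longrightarrow> \<delta> \<le> po \<Longrightarrow> packet_conds po \<delta> (\<Delta> \<delta>)"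
  shows "((\<lambda>\<delta>. Nbar (shift y0 (wave po (\<Delta> \<delta>)))) \<longlongrightarrow> ennreal (1/2 * (1 / (exp (2 * pi * po) - 1)))) (at_right 0)"
proof -
  define c0 where "c0 = complex_of_real (sqrt (2 * po)) * beta_amplitude po"
  \<comment> \<open>|c0|^2 is 2 po times 2 pi / (po (exp (2 pi po) - 1)), and 4 pi / (8 pi) leaves
    the 1/2.\<close>
  have L: "(cmod c0)\<^sup>2 / (8 * pi) = 1/2 * (1 / (exp (2 * pi * po) - 1))"
  proof -
    have "exp (2 * pi * po) > 1" using po by simp
    then show ?thesis using po
      by (simp add: c0_def norm_mult power_mult_distrib cmod_beta_amplitude divide_simps)
  qed
  obtain C1 where C1: "C1 \<ge> 0" "\<And>p k. p \<in> {po / 2..3 * po / 2} \<Longrightarrow> 0 < k \<Longrightarrow> k \<le> 1 \<Longrightarrow> cmod (beta_kernel p k) \<le> C1 * k"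
    using beta_kernel_small[of "po / 2"] po by (metis half_gt_zero)
  obtain C2 where C2: "C2 \<ge> 0" "\<And>p k. p \<in> {po / 2..3 * po / 2} \<Longrightarrow> k \<ge> 1 \<Longrightarrow>
      cmod (beta_kernel p k - beta_amplitude p * cis (p * ln k)) \<le> C2 / k"
    using beta_kernel_large[of "po / 2"] po by (metis half_gt_zero)
  define C where "C = max C1 C2"
  have C: "C \<ge> 0" using C1 by (simp add: C_def)
  have small: "cmod (beta_kernel p k) \<le> C * k" if "p \<in> {po / 2..3 * po / 2}" "0 < k" "k \<le> 1" for p k
    using C1(2)[OF that] that by (rule_tac order_trans) (auto simp: C_def intro!: mult_right_mono)
  have large: "cmod (beta_kernel p k - beta_amplitude p * cis (p * ln k)) \<le> C / k" if "p \<in> {po / 2..3 * po / 2}" "k \<ge> 1" for p k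
    using C2(2)[OF that] that by (rule_tac order_trans) (auto simp: C_def intro!: divide_right_mono)
  define l where "l = (cmod c0)\<^sup>2 / (8 * pi)"
  define M where "M = (cmod c0)\<^sup>2 * \<bar>y0\<bar> / (2 * pi\<^sup>2)"
  define R where "R = 2 * pi + 2 * (sqrt (3 * po) * C / (2 * pi))\<^sup>2 * (LINT s|lborel. exp (- (2 * \<bar>s\<bar>)))"
  define Q where "Q r = M * r\<^sup>2 + r * (l + M * r\<^sup>2) + (r\<^sup>2 + r) * R" for r
  define N where "N \<delta> = Nbar (shift y0 (wave po (\<Delta> \<delta>)))" for \<delta>
  have main: "\<forall>\<^sub>F \<delta> in at_right 0. N \<delta> = ennreal (enn2real (N \<delta>)) \<and> \<bar>enn2real (N \<delta>) - l\<bar> \<le> Q r" if r: "r > 0" for r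
  proof -
    have "isCont (\<lambda>p. complex_of_real (sqrt (2 * p)) * beta_amplitude p) po"
    proof -
      have "continuous_on {0<..} (\<lambda>p. complex_of_real (sqrt (2 * p)) * beta_amplitude p)"
        by (intro continuous_intros continuous_on_beta_amplitude)
      then show ?thesis using po by (simp add: continuous_on_eq_continuous_at)
    qed
    then obtain d where d: "d > 0" "\<And>p. dist p po < d \<Longrightarrow>
        dist (complex_of_real (sqrt (2 * p)) * beta_amplitude p) c0 < r"
      unfolding continuous_at_eps_delta c0_def using r by blast
    \<comment> \<open>po / 2 gives access to the locale, r^2 controls the L1 norm of D, and d the
      variation of the amplitude on the support.\<close>
    have "\<forall>\<^sub>F \<delta> in at_right 0. \<delta> \<in> {0<..<Min {po / 2, r\<^sup>2, d}}"
      using po r d by (intro eventually_at_right_real) auto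
    then show ?thesis
    proof eventually_elim
      case (elim \<delta>)
      then have \<delta>: "0 < \<delta>" "\<delta> \<le> po / 2" "\<delta> \<le> r\<^sup>2" "\<delta> < d" by auto
      interpret pk: packet po \<delta> "\<Delta> \<delta>" using po \<delta> D by unfold_locales auto
      have close: "cmod (complex_of_real (sqrt (2 * p)) * beta_amplitude p - complex_of_real (sqrt (2 * po)) * beta_amplitude po) \<le> r"
        if "p \<in> {po - \<delta>..po + \<delta>}" for p
      proof -
        have "\<bar>p - po\<bar> < d" using that \<delta> unfolding abs_less_iff by auto
        then show ?thesis using d(2)[of p] by (simp add: dist_norm c0_def)
      qed
      have "\<exists>n\<ge>0. N \<delta> = ennreal n \<and> \<bar>n - l\<bar> \<le> Q r"
        unfolding N_def Q_def M_def R_def l_def c0_def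
        by (rule pk.Nbar_estimate[OF C small large r \<delta>(3) close, of y0]) blast+
      then show ?case by auto
    qed
  qed
  have "(Q \<longlongrightarrow> M * 0\<^sup>2 + 0 * (l + M * 0\<^sup>2) + (0\<^sup>2 + 0) * R) (at_right 0)"
    unfolding Q_def[abs_def] by (intro tendsto_intros)
  then have Q0: "(Q \<longlongrightarrow> 0) (at_right 0)" by simp
  have lim: "((\<lambda>\<delta>. enn2real (N \<delta>)) \<longlongrightarrow> l) (at_right 0)"
  proof (rule tendstoI)
    fix e :: real assume "e > 0"
    then have "\<forall>\<^sub>F r in at_right 0. Q r < e \<and> r \<in> {0<..<1}"
      using order_tendstoD(2)[OF Q0] by (intro eventually_conj eventually_at_right_real) auto
    then obtain r where r: "Q r < e" "r > 0"
      using eventually_happens'[OF trivial_limit_at_right_real] by fastforce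
    show "\<forall>\<^sub>F \<delta> in at_right 0. dist (enn2real (N \<delta>)) l < e"
      using main[OF r(2)] by eventually_elim (use r in \<open>auto simp: dist_real_def\<close>)
  qed
  have "((\<lambda>\<delta>. ennreal (enn2real (N \<delta>))) \<longlongrightarrow> ennreal l) (at_right 0)"
    by (rule tendsto_ennrealI[OF lim])
  \<comment> \<open>\<open>enn2real\<close> sends infinity to 0, so finiteness of
    \<open>N \<delta>\<close> has to accompany the real limit.\<close>
  moreover have "\<forall>\<^sub>F \<delta> in at_right 0. ennreal (enn2real (N \<delta>)) = N \<delta>"
    using main[OF zero_less_one] by eventually_elim simp
  ultimately have "(N \<longlongrightarrow> ennreal l) (at_right 0)"
    by (simp cong: tendsto_cong)
  then show ?thesis unfolding N_def[abs_def] l_def L .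
qed

theorem theorem7:
  fixes po :: real and \<Delta> :: "real \<Rightarrow> real \<Rightarrow> real"
  assumes "po > 0"
    and "\<And>\<delta>. 0 < \<delta> \<Longrightarrow> \<delta> \<le> po \<Longrightarrow> packet_conds po \<delta> (\<Delta> \<delta>)"
  shows "\<forall>y0. ((\<lambda>\<delta>. Nbar (shift y0 (wave po (\<Delta> \<delta>))))
              \<longlongrightarrow> ennreal (1/2 * (1 / (exp (2 * pi * po) - 1)))) (at_right 0)
         \<and> (\<exists>L :: real \<Rightarrow> real.
           (\<forall>y0. ((\<lambda>\<delta>. enn2real (Nbar (shift y0 (wave po (\<Delta> \<delta>))))
                      - 1/2 * enn2real (NTh (shift y0 (wave po (\<Delta> \<delta>))))) \<longlongrightarrow> L y0) (at_right 0))
           \<and> (L \<longlongrightarrow> 0) at_top \<and> (L \<longlongrightarrow> 0) at_bot)"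
proof (intro allI conjI exI[of _ "\<lambda>_. 0"])
  fix y0
  show lim: "((\<lambda>\<delta>. Nbar (shift y0 (wave po (\<Delta> \<delta>)))) \<longlongrightarrow> ennreal (1/2 * (1 / (exp (2 * pi * po) - 1)))) (at_right 0)" for y0
    by (rule Nbar_limit[OF assms])
  have "((\<lambda>\<delta>. enn2real (Nbar (shift y0 (wave po (\<Delta> \<delta>))))) \<longlongrightarrow> 1/2 * (1 / (exp (2 * pi * po) - 1))) (at_right 0)"
    using assms(1) by (intro tendsto_enn2real lim) auto
  \<comment> \<open>Both limits are independent of y0 and cancel, so the constant 0 serves as L and
    its limits at infinity are immediate.\<close>
  from tendsto_diff[OF this tendsto_mult[OF tendsto_const NTh_limit[OF assms]], of "1/2" y0]
  show "((\<lambda>\<delta>. enn2real (Nbar (shift y0 (wave po (\<Delta> \<delta>))))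
      - 1/2 * enn2real (NTh (shift y0 (wave po (\<Delta> \<delta>))))) \<longlongrightarrow> 0) (at_right 0)"
    by simp
qed simp_all

end
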